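(* Let $k\ge 2$, $\boldsymbol{\alpha}=(\alpha_1,\dots,\alpha_k)\in(0,+\infty)^k$, and let $\mathbf{X}_n=(X_{1n},\dots,X_{kn})$, $n\in[N]$, be a random sample from the Dirichlet distribution $\mathcal{D}_k(\boldsymbol{\alpha})$. The maximum likelihood estimator (MLE) $\hat{\boldsymbol{\alpha}}=(\hat\alpha_1,\dots,\hat\alpha_k)$ of $\boldsymbol{\alpha}$, derived (whenever it exists) as the unique solution in $(0,+\infty)^k$ of the equation system $$\overline{\log X_i}=\psi(\hat\alpha_i)-\psi(\hat\alpha_0),\qquad i\in[k],\qquad \hat\alpha_0:=\sum_{j=1}^k\hat\alpha_j,$$ is a moment-type estimator with asymptotic variance-covariance matrix $\mathbb{V}(\log\mathbf{X})^{-1}$, where $\mathbf{X}\sim\mathcal{D}_k(\boldsymbol{\alpha})$ and $\log\mathbf{X}=(\log X_1,\dots,\log X_k)$.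
   Context: Notation: $[k]=\{1,\dots,k\}$; a random sample is an i.i.d. sample; $\overline{h(\mathbf{X})}:=\frac1N\sum_{n=1}^N h(\mathbf{X}_n)$, so $\overline{\log X_i}=\frac1N\sum_{n=1}^N\log X_{in}$. $\mathbb{V}$ denotes the variance-covariance matrix. $\Gamma$ is the gamma function and $\psi(a)=\frac{d}{da}\log\Gamma(a)$ the digamma function. Dirichlet distribution: $\mathbf{X}\sim\mathcal{D}_k(\boldsymbol{\alpha})$ has density, with respect to Lebesgue measure on $\mathbb{R}^{k-1}$ (using the first $k-1$ coordinates), $f(\mathbf{x};\boldsymbol{\alpha})=\frac{\Gamma(\alpha_0)}{\prod_{i=1}^k\Gamma(\alpha_i)}\prod_{i=1}^k x_i^{\alpha_i-1}$ on the open simplex $\{\mathbf{x}\in(0,1)^k:\sum_i x_i=1\}$, where $\alpha_0=\sum_{i=1}^k\alpha_i$. Moment-type estimator: for a parametric family with support $\mathbf{S}\subset\mathbb{R}^k$ and parameter space $\boldsymbol{\Theta}\subset\mathbb{R}^d$, let $h:\mathbf{S}\to\mathbb{R}^m$ be such that $e_h:\boldsymbol{\Theta}\to\mathbb{R}^m$, $e_h(\boldsymbol{\theta})=\mathbb{E}_{\boldsymbol{\theta}}(h(\mathbf{X}))$, is injective, and let $g:\mathbb{R}^m\to\mathbb{R}^d$ satisfy $g|_{e_h(\boldsymbol{\Theta})}=e_h^{-1}$. The estimator $\tilde{\boldsymbol{\theta}}_N=g(\overline{h(\mathbf{X})})$ is called a moment-type estimator of $\boldsymbol{\theta}$; it exists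 as long as $\tilde{\boldsymbol{\theta}}_N\in\boldsymbol{\Theta}$. An estimator $\tilde{\boldsymbol{\theta}}_N$ that exists with probability tending to 1 as $N\to\infty$ has asymptotic variance-covariance matrix $\boldsymbol{\Sigma}$ if $\sqrt{N}(\tilde{\boldsymbol{\theta}}_N-\boldsymbol{\theta})$ converges in law, under $\boldsymbol{\theta}$, to the centered normal distribution with covariance matrix $\boldsymbol{\Sigma}$ as $N\to\infty$. *)

theory Defs
  imports "HOL-Probability.Probability"
begin

subsection \<open>Convergence in law, covariance matrices and normal laws on \<open>real ^ 'd\<close>\<close>

definition converges_in_law :: "(nat \<Rightarrow> 'b :: topological_space measure) \<Rightarrow> 'b measure \<Rightarrow> bool" where
  "converges_in_law \<mu> \<nu> \<longleftrightarrow>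
     (\<forall>f :: 'b \<Rightarrow> real. continuous_on UNIV f \<and> bounded (range f) \<longrightarrow>
        (\<lambda>n. \<integral>x. f x \<partial>\<mu> n) \<longlonglongrightarrow> (\<integral>x. f x \<partial>\<nu>))"

definition covariance_matrix :: "'a measure \<Rightarrow> ('a \<Rightarrow> real ^ 'd) \<Rightarrow> real ^ 'd ^ 'd" where
  "covariance_matrix M Y =
     (\<chi> i j. \<integral>\<omega>. (Y \<omega> $ i - (\<integral>\<omega>'. Y \<omega>' $ i \<partial>M)) * (Y \<omega> $ j - (\<integral>\<omega>'. Y \<omega>' $ j \<partial>M)) \<partial>M)"

definition std_normal_vec :: "(real ^ 'd) measure" where
  "std_normal_vec = density lborel (\<lambda>z. ennreal (\<Prod>i\<in>UNIV. std_normal_density (z $ i)))"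

text \<open>
  The centered normal law with covariance matrix \<open>\<Sigma>\<close> is the law of \<open>A Z\<close>, where \<open>Z\<close> has
  independent standard normal components and \<open>A A\<^sup>T = \<Sigma>\<close>. It does not depend on the choice
  of \<open>A\<close>, and a singular \<open>\<Sigma>\<close> is allowed.
\<close>

definition centered_normal :: "real ^ 'd ^ 'd \<Rightarrow> (real ^ 'd) measure \<Rightarrow> bool" where
  "centered_normal \<Sigma> \<mu> \<longleftrightarrow>
     (\<exists>A :: real ^ 'd ^ 'd. A ** transpose A = \<Sigma> \<and> \<mu> = distr std_normal_vec borel (\<lambda>z. A *v z))"


subsection \<open>Estimators\<close>

definition sample_mean :: "('x \<Rightarrow> real ^ 'm) \<Rightarrow> nat \<Rightarrow> (nat \<Rightarrow> 'x) \<Rightarrow> real ^ 'm" where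
  "sample_mean h N x = (1 / real N) *\<^sub>R (\<Sum>n = 1..N. h (x n))"

text \<open>
  An estimator maps the sample size \<open>N\<close> and a sample \<open>x 1, \<dots>, x N\<close> to an optional value,
  \<open>None\<close> meaning that the estimator does not exist for this sample.
\<close>

definition moment_map :: "('p \<Rightarrow> 'x measure) \<Rightarrow> ('x \<Rightarrow> real ^ 'm) \<Rightarrow> 'p \<Rightarrow> real ^ 'm" where
  "moment_map P h \<theta> = (\<integral>x. h x \<partial>P \<theta>)"

definition moment_type_estimator ::
  "(real ^ 'd \<Rightarrow> (real ^ 'k) measure) \<Rightarrow> (real ^ 'd) set \<Rightarrow> (real ^ 'k) set \<Rightarrow>
   (real ^ 'k \<Rightarrow> real ^ 'm) \<Rightarrow> (nat \<Rightarrow> (nat \<Rightarrow> real ^ 'k) \<Rightarrow> (real ^ 'd) option) \<Rightarrow> bool" where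
  "moment_type_estimator P \<Theta> S h T \<longleftrightarrow>
     (\<forall>\<theta>\<in>\<Theta>. integrable (P \<theta>) h) \<and>
     inj_on (moment_map P h) \<Theta> \<and>
     (\<exists>g :: real ^ 'm \<Rightarrow> real ^ 'd.
        (\<forall>\<theta>\<in>\<Theta>. g (moment_map P h \<theta>) = \<theta>) \<and>
        (\<forall>N\<ge>1. \<forall>x. (\<forall>n\<in>{1..N}. x n \<in> S) \<longrightarrow>
           T N x = (if g (sample_mean h N x) \<in> \<Theta> then Some (g (sample_mean h N x)) else None)))"

definition is_maximum_likelihood ::
  "('p \<Rightarrow> 'x \<Rightarrow> real) \<Rightarrow> 'p set \<Rightarrow> nat \<Rightarrow> (nat \<Rightarrow> 'x) \<Rightarrow> 'p \<Rightarrow> bool" where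
  "is_maximum_likelihood f \<Theta> N x \<theta> \<longleftrightarrow>
     \<theta> \<in> \<Theta> \<and> (\<forall>\<theta>'\<in>\<Theta>. (\<Prod>n = 1..N. f \<theta>' (x n)) \<le> (\<Prod>n = 1..N. f \<theta> (x n)))"

definition mle ::
  "('p \<Rightarrow> 'x \<Rightarrow> real) \<Rightarrow> 'p set \<Rightarrow> nat \<Rightarrow> (nat \<Rightarrow> 'x) \<Rightarrow> 'p option" where
  "mle f \<Theta> N x =
     (if \<exists>!\<theta>. is_maximum_likelihood f \<Theta> N x \<theta>
      then Some (THE \<theta>. is_maximum_likelihood f \<Theta> N x \<theta>) else None)"

text \<open>
  In the next two definitions \<open>T N \<omega>\<close> is the value of the estimator on the first \<open>N\<close>
  observations. Where the estimator does not exist the rescaled error is set to \<open>0\<close>; the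
  value chosen there does not affect the limit law, as the probability of this event tends to 0.
\<close>

definition rescaled_error ::
  "real ^ 'd \<Rightarrow> (nat \<Rightarrow> 'a \<Rightarrow> (real ^ 'd) option) \<Rightarrow> nat \<Rightarrow> 'a \<Rightarrow> real ^ 'd" where
  "rescaled_error \<theta> T N \<omega> =
     (case T N \<omega> of Some t \<Rightarrow> sqrt (real N) *\<^sub>R (t - \<theta>) | None \<Rightarrow> 0)"

definition has_asymptotic_covariance ::
  "'a measure \<Rightarrow> real ^ 'd \<Rightarrow> (nat \<Rightarrow> 'a \<Rightarrow> (real ^ 'd) option) \<Rightarrow> real ^ 'd ^ 'd \<Rightarrow> bool" where
  "has_asymptotic_covariance M \<theta> T \<Sigma> \<longleftrightarrow>
     (\<forall>N\<ge>1. {\<omega> \<in> space M. T N \<omega> \<noteq> None} \<in> sets M) \<and>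
     (\<lambda>N. measure M {\<omega> \<in> space M. T N \<omega> \<noteq> None}) \<longlonglongrightarrow> 1 \<and>
     (\<forall>N\<ge>1. rescaled_error \<theta> T N \<in> borel_measurable M) \<and>
     (\<exists>\<mu>. centered_normal \<Sigma> \<mu> \<and>
        converges_in_law (\<lambda>N. distr M borel (rescaled_error \<theta> T N)) \<mu>)"


subsection \<open>The Dirichlet distribution\<close>

definition open_simplex :: "(real ^ 'k) set" where
  "open_simplex = {x. (\<forall>i. 0 < x $ i \<and> x $ i < 1) \<and> (\<Sum>i\<in>UNIV. x $ i) = 1}"

definition positive_vecs :: "(real ^ 'k) set" where
  "positive_vecs = {\<alpha>. \<forall>i. 0 < \<alpha> $ i}"

definition dirichlet_density :: "real ^ 'k \<Rightarrow> real ^ 'k \<Rightarrow> real" where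
  "dirichlet_density \<alpha> x =
     (if x \<in> open_simplex
      then Gamma (\<Sum>i\<in>UNIV. \<alpha> $ i) / (\<Prod>i\<in>UNIV. Gamma (\<alpha> $ i)) * (\<Prod>i\<in>UNIV. x $ i powr (\<alpha> $ i - 1))
      else 0)"

text \<open>
  The linear order on the index type singles out the last coordinate \<open>Max UNIV\<close>. The space
  \<open>\<real>\<^sup>k\<^sup>-\<^sup>1\<close> of the remaining coordinates is the product space over \<open>UNIV - {Max UNIV}\<close>, and
  \<open>simplex_point\<close> recovers the last coordinate from them.
\<close>

definition simplex_point :: "('k \<Rightarrow> real) \<Rightarrow> (real, 'k :: {finite, linorder}) vec" where
  "simplex_point y =
     (\<chi> i. if i = Max UNIV then 1 - (\<Sum>j\<in>UNIV - {Max UNIV}. y j) else y i)"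

definition dirichlet :: "(real, 'k :: {finite, linorder}) vec \<Rightarrow> (real, 'k) vec measure" where
  "dirichlet \<alpha> =
     distr
       (density (\<Pi>\<^sub>M i\<in>UNIV - {Max UNIV :: 'k}. lborel)
          (\<lambda>y. ennreal (dirichlet_density \<alpha> (simplex_point y))))
       borel simplex_point"

definition log_vec :: "real ^ 'k \<Rightarrow> real ^ 'k" where
  "log_vec x = (\<chi> i. ln (x $ i))"

definition dirichlet_likelihood_system :: "nat \<Rightarrow> (nat \<Rightarrow> real ^ 'k) \<Rightarrow> real ^ 'k \<Rightarrow> bool" where
  "dirichlet_likelihood_system N x a \<longleftrightarrow>
     (\<forall>i. (1 / real N) * (\<Sum>n = 1..N. ln (x n $ i)) = Digamma (a $ i) - Digamma (\<Sum>j\<in>UNIV. a $ j))"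

abbreviation dirichlet_mle :: "nat \<Rightarrow> (nat \<Rightarrow> real ^ 'k) \<Rightarrow> (real ^ 'k) option" where
  "dirichlet_mle \<equiv> mle dirichlet_density positive_vecs"

end

theory Submission
  imports Defs
begin

text \<open>
  The parameter enters the Dirichlet density only through the exponential-family form
  \<open>exp ((\<alpha> - 1) \<bullet> log x - A \<alpha>)\<close> with \<open>A \<alpha> = (\<Sum>i. ln \<Gamma>(\<alpha> i)) - ln \<Gamma>(\<Sum>i. \<alpha> i)\<close>, and everything follows
  from this (\<open>dirichlet_density_exp\<close>). Since every \<open>\<alpha>\<close> in the positive orthant gives a probability
  density, the moment generating function of \<open>u \<bullet> log X\<close> is \<open>exp (A (\<alpha> + t u) - A \<alpha>)\<close>
  (\<open>dirichlet_mgf\<close>). Its first two derivatives at \<open>0\<close> identify the mean of \<open>log X\<close> with the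
  gradient \<open>e \<alpha>\<close> of \<open>A\<close>, whose components are \<open>\<psi>(\<alpha> i) - \<psi>(\<Sum>j. \<alpha> j)\<close>, and the covariance matrix with the
  Hessian \<open>J \<alpha>\<close> of \<open>A\<close> (\<open>covariance_matrix_log_dirichlet\<close>).

  The Hessian is positive definite because \<open>log X\<close> does not live on a hyperplane: all Dirichlet laws
  have the same null sets, so a relation \<open>u \<bullet> log X = c\<close> would force \<open>u \<bullet> e \<beta> = c\<close> for every \<open>\<beta>\<close>,
  which the functional equation of the digamma function excludes unless \<open>u = 0\<close>
  (\<open>log_dirichlet_not_in_hyperplane\<close>). Hence \<open>A\<close> is strictly convex. The log-likelihood is \<open>N\<close> times
  \<open>(a - 1) \<bullet> L - A a\<close>, where \<open>L\<close> is the sample mean of the \<open>log X\<close>, so its maximizers are exactly the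
  solutions of \<open>e a = L\<close>, and there is at most one (\<open>is_maximum_likelihood_dirichlet_iff\<close>). The
  maximum likelihood estimator is therefore \<open>e\<close> inverse applied to \<open>L\<close>, a moment-type estimator.

  For the limit law, invariance of domain makes the image of \<open>e\<close> open and the inverse of \<open>e\<close>
  continuous, and the inverse is differentiable with derivative \<open>J \<alpha>\<close> inverse. The central limit
  theorem for \<open>L\<close> and the delta method give the limit \<open>J\<^sup>-\<^sup>1 Z\<close> with \<open>Z\<close> centered normal with
  covariance \<open>J\<close>, so the limit covariance is \<open>J\<^sup>-\<^sup>1 J J\<^sup>-\<^sup>1 = J\<^sup>-\<^sup>1\<close>. Both steps are
  carried out on characteristic functions: the one-dimensional central limit theorem handles each
  projection, and convergence in law in several dimensions is recovered from a continuity theorem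
  (\<open>converges_in_law_characteristic_function\<close>) that rests on the Stone-Weierstrass theorem for
  trigonometric sums. If an observation lies outside the open simplex, all likelihoods vanish and the
  estimator does not exist; on the remaining event it is a Borel function of \<open>L\<close>, which gives the
  required measurability.
\<close>


section \<open>Convergence in law from characteristic functions\<close>

text \<open>
  Waves with a free phase \<open>b\<close> cover sine, cosine and constants at once, and make closure under
  products a single instance of the product formula for cosines.
\<close>

inductive trig_sum :: "('b::euclidean_space \<Rightarrow> real) \<Rightarrow> bool" where
  wave: "trig_sum (\<lambda>x. c * cos (u \<bullet> x + b))"
| add: "trig_sum f \<Longrightarrow> trig_sum g \<Longrightarrow> trig_sum (\<lambda>x. f x + g x)"

lemma trig_sum_const: "trig_sum (\<lambda>x. c)"
  using wave[of c 0 0] by simp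

lemma trig_sum_mult:
  assumes "trig_sum f" "trig_sum g"
  shows "trig_sum (\<lambda>x. f x * g x)"
  using assms(1)
proof induction
  case (wave c u b)
  show ?case using assms(2)
  proof induction
    case (wave d v b')
    have "trig_sum (\<lambda>x. c * d / 2 * cos ((u - v) \<bullet> x + (b - b')) + c * d / 2 * cos ((u + v) \<bullet> x + (b + b')))"
      by (intro trig_sum.intros)
    also have "(\<lambda>x. c * d / 2 * cos ((u - v) \<bullet> x + (b - b')) + c * d / 2 * cos ((u + v) \<bullet> x + (b + b')))
       = (\<lambda>x. (c * cos (u \<bullet> x + b)) * (d * cos (v \<bullet> x + b')))"
    proof
      fix x
      have 1: "(u - v) \<bullet> x + (b - b') = (u \<bullet> x + b) - (v \<bullet> x + b')"
        and 2: "(u + v) \<bullet> x + (b + b') = (u \<bullet> x + b) + (v \<bullet> x + b')"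
        by (auto simp: inner_diff_left inner_add_left)
      show "c * d / 2 * cos ((u - v) \<bullet> x + (b - b')) + c * d / 2 * cos ((u + v) \<bullet> x + (b + b'))
         = (c * cos (u \<bullet> x + b)) * (d * cos (v \<bullet> x + b'))"
        unfolding 1 2 cos_add cos_diff by (simp add: algebra_simps)
    qed
    finally show ?case .
  next
    case (add f g)
    then show ?case by (simp add: distrib_left trig_sum.add)
  qed
next
  case (add f g)
  then show ?case by (simp add: distrib_right trig_sum.add)
qed

lemma trig_sum_continuous: "trig_sum f \<Longrightarrow> continuous_on S f"
  by (induction rule: trig_sum.induct) (auto intro!: continuous_intros)

lemma trig_sum_bounded: "trig_sum f \<Longrightarrow> \<exists>K. \<forall>x. \<bar>f x\<bar> \<le> K"
proof (induction rule: trig_sum.induct)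
  case (wave c u b)
  have "\<bar>c * cos (u \<bullet> x + b)\<bar> \<le> \<bar>c\<bar>" for x
    by (simp add: abs_mult mult_left_le)
  then show ?case by blast
next
  case (add f g)
  then obtain K L where "\<forall>x. \<bar>f x\<bar> \<le> K" "\<forall>x. \<bar>g x\<bar> \<le> L" by blast
  then have "\<bar>f x + g x\<bar> \<le> K + L" for x
    using add_mono abs_triangle_ineq order_trans by meson
  then show ?case by blast
qed

lemma trig_sum_polynomial:
  fixes p :: "real \<Rightarrow> real"
  assumes "real_polynomial_function p" and "trig_sum f"
  shows "trig_sum (\<lambda>x. p (f x))"
  using assms(1)
proof induction
  case (linear h)
  then have "h (f x) = f x * h 1" for x
    using linear_cmul[OF bounded_linear.linear[OF linear], of "f x" 1] by simp
  then show ?case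
    using trig_sum_mult[OF assms(2) trig_sum_const[of "h 1"]] by simp
qed (auto intro: trig_sum_const trig_sum.add trig_sum_mult)

text \<open>
  Stone-Weierstrass alone approximates on a compact set but says nothing about the approximant
  elsewhere. Here the approximant also keeps the global bound of \<open>f\<close> up to \<open>\<epsilon>\<close>, so that the
  mass of a tight family outside the compact set contributes little.
\<close>

lemma trig_sum_approx:
  fixes f :: "'b::euclidean_space \<Rightarrow> real"
  assumes cont: "continuous_on UNIV f" and B: "\<And>x. \<bar>f x\<bar> \<le> B" and K: "compact K" and "0 < \<epsilon>"
  obtains p where "trig_sum p" "\<And>x. x \<in> K \<Longrightarrow> \<bar>f x - p x\<bar> \<le> \<epsilon>" "\<And>x. \<bar>p x\<bar> \<le> B + \<epsilon>"
proof -
  have "\<exists>q. trig_sum q \<and> (\<forall>x\<in>K. \<bar>f x - q x\<bar> < \<epsilon> / 2)"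
  proof (rule Stone_Weierstrass_HOL[OF K])
    fix x y :: 'b assume "x \<in> K \<and> y \<in> K \<and> x \<noteq> y"
    \<comment> \<open>the wave along \<open>x - y\<close> with phase \<open>0\<close> at \<open>y\<close> and phase \<open>\<pi>\<close> at \<open>x\<close> separates the two points\<close>
    define u where "u = (pi / (norm (x - y))\<^sup>2) *\<^sub>R (x - y)"
    have "x - y \<noteq> 0" using \<open>_ \<and> _\<close> by auto
    then have "u \<bullet> (x - y) = pi"
      by (simp add: u_def power2_norm_eq_inner)
    then have "1 * cos (u \<bullet> x + - (u \<bullet> y)) \<noteq> 1 * cos (u \<bullet> y + - (u \<bullet> y))"
      by (simp add: inner_diff_right)
    then show "\<exists>q. trig_sum q \<and> q x \<noteq> q y"
      using trig_sum.wave[of 1 u "- (u \<bullet> y)"] by metis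
  qed (use \<open>0 < \<epsilon>\<close> in \<open>auto intro: trig_sum_const trig_sum.add trig_sum_mult trig_sum_continuous
      continuous_on_subset[OF cont]\<close>)
  then obtain q where q: "trig_sum q" "\<And>x. x \<in> K \<Longrightarrow> \<bar>f x - q x\<bar> < \<epsilon> / 2" by blast
  obtain L where L: "\<And>x. \<bar>q x\<bar> \<le> L" using trig_sum_bounded[OF q(1)] by blast
  \<comment> \<open>\<open>q\<close> is only controlled on \<open>K\<close>; clipping it to \<open>[-B, B]\<close> repairs this, and replacing the clipping
    by a polynomial \<open>r\<close> on the range of \<open>q\<close> keeps the result a trigonometric sum\<close>
  define clip where "clip z = max (-B) (min B z)" for z :: real
  have "continuous_on {-L..L} clip" unfolding clip_def by (intro continuous_intros)
  then obtain r where r: "real_polynomial_function r" "\<And>z. z \<in> {-L..L} \<Longrightarrow> \<bar>clip z - r z\<bar> < \<epsilon> / 2"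
    using Stone_Weierstrass_real_polynomial_function[of "{-L..L}" clip "\<epsilon> / 2"] \<open>0 < \<epsilon>\<close> by auto
  have near: "\<bar>clip (q x) - r (q x)\<bar> < \<epsilon> / 2" for x
    using L[of x] by (intro r(2)) auto
  show ?thesis
  proof (rule that[of "\<lambda>x. r (q x)"])
    show "trig_sum (\<lambda>x. r (q x))" by (rule trig_sum_polynomial[OF r(1) q(1)])
  next
    fix x assume "x \<in> K"
    have "\<bar>f x - clip (q x)\<bar> \<le> \<bar>f x - q x\<bar>" using B[of x] unfolding clip_def by auto
    then show "\<bar>f x - r (q x)\<bar> \<le> \<epsilon>" using near[of x] q(2)[OF \<open>x \<in> K\<close>] by linarith
  next
    fix x
    have "0 \<le> B" using B[of x] by linarith
    then have "\<bar>clip (q x)\<bar> \<le> B" unfolding clip_def by auto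
    then show "\<bar>r (q x)\<bar> \<le> B + \<epsilon>" using near[of x] \<open>0 < \<epsilon>\<close> by linarith
  qed
qed

text \<open>
  Integrals of waves are read off from the characteristic function, so convergence of characteristic
  functions is convergence of integrals of trigonometric sums.
\<close>

lemma integral_wave:
  fixes \<mu> :: "'b::euclidean_space measure"
  assumes "prob_space \<mu>" and [measurable_cong]: "sets \<mu> = sets borel"
  shows "(\<integral>x. c * cos (u \<bullet> x + b) \<partial>\<mu>) = c * Re (cis b * (\<integral>x. cis (u \<bullet> x) \<partial>\<mu>))"
proof -
  interpret prob_space \<mu> by fact
  have int: "integrable \<mu> (\<lambda>x. cis (u \<bullet> x))"
    by (rule integrable_const_bound[of _ 1]) (auto simp: cis_conv_exp)
  have "Re (cis b * (\<integral>x. cis (u \<bullet> x) \<partial>\<mu>)) = Re (\<integral>x. cis b * cis (u \<bullet> x) \<partial>\<mu>)"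
    by simp
  also have "\<dots> = (\<integral>x. Re (cis b * cis (u \<bullet> x)) \<partial>\<mu>)"
    by (rule integral_Re[symmetric]) (use int in simp)
  also have "\<dots> = (\<integral>x. cos (u \<bullet> x + b) \<partial>\<mu>)"
    by (simp add: cis_mult add.commute)
  finally show ?thesis by simp
qed

lemma trig_sum_integrable:
  fixes \<mu> :: "'b::euclidean_space measure"
  assumes "prob_space \<mu>" and [measurable_cong]: "sets \<mu> = sets borel" and "trig_sum p"
  shows "integrable \<mu> p"
proof -
  interpret prob_space \<mu> by fact
  obtain K where "\<forall>x. \<bar>p x\<bar> \<le> K" using trig_sum_bounded assms(3) by blast
  then show ?thesis
    using borel_measurable_continuous_onI[OF trig_sum_continuous[OF assms(3)]]
    by (intro integrable_const_bound[of _ K]) auto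
qed

lemma tendsto_integral_trig_sum:
  fixes \<mu> :: "nat \<Rightarrow> 'b::euclidean_space measure" and \<nu> :: "'b measure"
  assumes \<mu>: "\<And>n. prob_space (\<mu> n)" "\<And>n. sets (\<mu> n) = sets borel"
    and \<nu>: "prob_space \<nu>" "sets \<nu> = sets borel"
    and conv: "\<And>u. (\<lambda>n. \<integral>x. cis (u \<bullet> x) \<partial>\<mu> n) \<longlonglongrightarrow> (\<integral>x. cis (u \<bullet> x) \<partial>\<nu>)"
    and "trig_sum p"
  shows "(\<lambda>n. \<integral>x. p x \<partial>\<mu> n) \<longlonglongrightarrow> (\<integral>x. p x \<partial>\<nu>)"
  using assms(6)
proof induction
  case (wave c u b)
  show ?case
    unfolding integral_wave[OF \<mu>] integral_wave[OF \<nu>] by (intro tendsto_intros conv)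
next
  case (add f g)
  then show ?case
    by (simp add: Bochner_Integration.integral_add trig_sum_integrable \<mu> \<nu> tendsto_add)
qed

text \<open>
  Convergence of characteristic functions restricts to each coordinate, where the one-dimensional
  continuity theorem turns it into weak convergence. The limit law of each coordinate has little mass
  far out, weak convergence transfers this to the sequence, and finitely many coordinates bound the norm.
\<close>

lemma characteristic_function_imp_tight:
  fixes \<mu> :: "nat \<Rightarrow> 'b::euclidean_space measure" and \<nu> :: "'b measure"
  assumes \<mu>: "\<And>n. prob_space (\<mu> n)" "\<And>n. sets (\<mu> n) = sets borel"
    and \<nu>: "prob_space \<nu>" "sets \<nu> = sets borel"
    and conv: "\<And>u. (\<lambda>n. \<integral>x. cis (u \<bullet> x) \<partial>\<mu> n) \<longlonglongrightarrow> (\<integral>x. cis (u \<bullet> x) \<partial>\<nu>)"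
    and "0 < \<epsilon>"
  obtains R where "measure \<nu> {x. R < norm x} < \<epsilon>" "\<forall>\<^sub>F n in sequentially. measure (\<mu> n) {x. R < norm x} < \<epsilon>"
proof -
  interpret \<nu>: prob_space \<nu> by fact
  note [measurable_cong] = \<mu>(2) \<nu>(2)
  \<comment> \<open>a continuous stand-in for the indicator of \<open>R < \<bar>t\<bar>\<close>, at least the indicator of \<open>R + 1 \<le> \<bar>t\<bar>\<close>\<close>
  define h :: "nat \<Rightarrow> real \<Rightarrow> real" where "h R t = min 1 (max 0 (\<bar>t\<bar> - real R))" for R t
  have h_cont: "continuous_on S (h R)" for R S unfolding h_def by (intro continuous_intros)
  have h_meas[measurable]: "h R \<in> borel_measurable borel" for R
    by (intro borel_measurable_continuous_onI h_cont)
  have h_bound: "0 \<le> h R t" "h R t \<le> 1" for R t unfolding h_def by auto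
  have h_int: "integrable M (\<lambda>x. h R (x \<bullet> b))" if "prob_space M" "sets M = sets borel" for M and b :: 'b and R
  proof -
    interpret prob_space M by fact
    note [measurable_cong] = that(2)
    show ?thesis using h_bound by (intro integrable_const_bound[of _ 1]) auto
  qed
  define H where "H R x = (\<Sum>b\<in>Basis. h R (x \<bullet> b))" for R and x :: 'b
  have H_int: "integrable M (H R)" if "prob_space M" "sets M = sets borel" for M R
    unfolding H_def by (intro Bochner_Integration.integrable_sum h_int that)
  have coord: "(\<lambda>n. \<integral>x. h R (x \<bullet> b) \<partial>\<mu> n) \<longlonglongrightarrow> (\<integral>x. h R (x \<bullet> b) \<partial>\<nu>)" for b :: 'b and R
  proof -
    have rd: "real_distribution (distr (\<mu> n) borel (\<lambda>x. x \<bullet> b))" for n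
    proof -
      interpret prob_space "\<mu> n" by fact
      show ?thesis by (rule real_distribution_distr) simp
    qed
    have rd': "real_distribution (distr \<nu> borel (\<lambda>x. x \<bullet> b))"
      by (rule \<nu>.real_distribution_distr) simp
    have ch: "char (distr M borel (\<lambda>x. x \<bullet> b)) t = (\<integral>x. cis ((t *\<^sub>R b) \<bullet> x) \<partial>M)"
      if [measurable_cong]: "sets M = sets borel" for M t
      unfolding char_def cis_conv_exp
      by (subst integral_distr) (auto simp: inner_commute)
    have "weak_conv_m (\<lambda>n. distr (\<mu> n) borel (\<lambda>x. x \<bullet> b)) (distr \<nu> borel (\<lambda>x. x \<bullet> b))"
      by (rule levy_continuity[OF rd rd']) (simp only: ch \<mu> \<nu> conv)
    then have "(\<lambda>n. integral\<^sup>L (distr (\<mu> n) borel (\<lambda>x. x \<bullet> b)) (h R))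
        \<longlonglongrightarrow> integral\<^sup>L (distr \<nu> borel (\<lambda>x. x \<bullet> b)) (h R)"
      using h_bound h_cont[of UNIV R]
      by (intro weak_conv_imp_integral_bdd_continuous_conv[OF rd rd', where B = 1])
        (auto simp: continuous_on_eq_continuous_at)
    then show ?thesis by (simp add: integral_distr)
  qed
  have H_conv: "(\<lambda>n. \<integral>x. H R x \<partial>\<mu> n) \<longlonglongrightarrow> (\<integral>x. H R x \<partial>\<nu>)" for R
    unfolding H_def
    by (simp add: Bochner_Integration.integral_sum h_int \<mu> \<nu>) (intro tendsto_sum coord)
  have "(\<lambda>R. \<integral>x. H R x \<partial>\<nu>) \<longlonglongrightarrow> (\<integral>x. 0 \<partial>\<nu>)"
  proof (rule integral_dominated_convergence[where w = "\<lambda>_. real DIM('b)"])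
    show "AE x in \<nu>. (\<lambda>R. H R x) \<longlonglongrightarrow> 0"
    proof (rule AE_I2)
      fix x :: 'b
      have "\<forall>\<^sub>F R in sequentially. H R x = 0"
      proof (rule eventually_sequentiallyI[of "nat \<lceil>norm x\<rceil>"])
        fix R assume "nat \<lceil>norm x\<rceil> \<le> R"
        then have "norm x \<le> real R" by linarith
        then have "h R (x \<bullet> b) = 0" if "b \<in> Basis" for b
          using Basis_le_norm[OF that, of x] by (auto simp: h_def)
        then show "H R x = 0" by (simp add: H_def)
      qed
      then show "(\<lambda>R. H R x) \<longlonglongrightarrow> 0" by (rule tendsto_eventually)
    qed
    show "AE x in \<nu>. norm (H i x) \<le> real DIM('b)" for i
    proof (rule AE_I2)
      fix x :: 'b
      have "0 \<le> H i x" unfolding H_def by (intro sum_nonneg h_bound)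
      moreover have "H i x \<le> (\<Sum>b\<in>(Basis::'b set). 1)" unfolding H_def by (intro sum_mono h_bound)
      ultimately show "norm (H i x) \<le> real DIM('b)" by simp
    qed
  qed (auto simp: H_def)
  then have "\<forall>\<^sub>F R in sequentially. (\<integral>x. H R x \<partial>\<nu>) < \<epsilon>"
    using \<open>0 < \<epsilon>\<close> by (intro order_tendstoD(2)[of _ 0]) auto
  then obtain R where R: "(\<integral>x. H R x \<partial>\<nu>) < \<epsilon>" by (auto simp: eventually_sequentially)
  \<comment> \<open>a vector longer than \<open>R'\<close> has a coordinate beyond \<open>R + 1\<close>, by comparison with the \<open>1\<close>-norm\<close>
  define R' where "R' = real DIM('b) * (real R + 1)"
  have H_ge: "indicator {x. R' < norm x} x \<le> H R x" for x
  proof (cases "R' < norm x")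
    case True
    have "\<exists>b\<in>Basis. real R + 1 \<le> \<bar>x \<bullet> b\<bar>"
    proof (rule ccontr)
      assume "\<not> ?thesis"
      then have "(\<Sum>b\<in>Basis. \<bar>x \<bullet> b\<bar>) \<le> (\<Sum>b\<in>(Basis::'b set). real R + 1)"
        by (intro sum_mono) auto
      then show False using norm_le_l1[of x] True by (simp add: R'_def)
    qed
    then obtain b where b: "b \<in> Basis" "real R + 1 \<le> \<bar>x \<bullet> b\<bar>" by blast
    then have "1 \<le> h R (x \<bullet> b)" by (simp add: h_def)
    also have "\<dots> \<le> H R x" unfolding H_def by (intro member_le_sum b h_bound) auto
    finally show ?thesis using True by simp
  next
    case False
    then show ?thesis by (auto simp: H_def intro!: sum_nonneg h_bound)
  qed
  have le: "measure M {x. R' < norm x} \<le> (\<integral>x. H R x \<partial>M)"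
    if "prob_space M" and [measurable_cong]: "sets M = sets borel" for M
  proof -
    interpret prob_space M by fact
    have [measurable]: "{x. R' < norm x} \<in> sets M" by simp
    have "measure M {x. R' < norm x} = (\<integral>x. indicator {x. R' < norm x} x \<partial>M)"
      by (simp add: sets_eq_imp_space_eq[OF that(2)])
    also have "\<dots> \<le> (\<integral>x. H R x \<partial>M)"
      by (intro integral_mono H_int that H_ge integrable_real_indicator) (auto simp: less_top[symmetric])
    finally show ?thesis .
  qed
  have "\<forall>\<^sub>F n in sequentially. (\<integral>x. H R x \<partial>\<mu> n) < \<epsilon>"
    by (rule order_tendstoD(2)[OF H_conv R])
  then have "\<forall>\<^sub>F n in sequentially. measure (\<mu> n) {x. R' < norm x} < \<epsilon>"
    by (rule eventually_mono) (use le[OF \<mu>] in \<open>rule le_less_trans\<close>)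
  then show ?thesis using le[OF \<nu>] R by (intro that[of R']) auto
qed

text \<open>
  The continuity theorem of Levy in several dimensions. By tightness a bounded continuous \<open>f\<close> needs
  approximation only on a large ball, by a trigonometric sum that is bounded everywhere; integrals of
  trigonometric sums converge by hypothesis.
\<close>

theorem converges_in_law_characteristic_function:
  fixes \<mu> :: "nat \<Rightarrow> 'b::euclidean_space measure" and \<nu> :: "'b measure"
  assumes \<mu>: "\<And>n. prob_space (\<mu> n)" "\<And>n. sets (\<mu> n) = sets borel"
    and \<nu>: "prob_space \<nu>" "sets \<nu> = sets borel"
    and conv: "\<And>u. (\<lambda>n. \<integral>x. cis (u \<bullet> x) \<partial>\<mu> n) \<longlonglongrightarrow> (\<integral>x. cis (u \<bullet> x) \<partial>\<nu>)"
  shows "converges_in_law \<mu> \<nu>"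
  unfolding converges_in_law_def
proof (intro allI impI, elim conjE)
  fix f :: "'b \<Rightarrow> real" assume f: "continuous_on UNIV f" "bounded (range f)"
  obtain B where B: "\<And>x. \<bar>f x\<bar> \<le> B" using f(2) by (auto simp: bounded_iff)
  have "0 \<le> B" using B[of 0] by linarith
  have f_int: "integrable M f" if "prob_space M" and [measurable_cong]: "sets M = sets borel" for M
  proof -
    interpret prob_space M by fact
    show ?thesis using B borel_measurable_continuous_onI[OF f(1)]
      by (intro integrable_const_bound[of _ B]) auto
  qed
  show "(\<lambda>n. \<integral>x. f x \<partial>\<mu> n) \<longlonglongrightarrow> (\<integral>x. f x \<partial>\<nu>)"
  proof (rule LIMSEQ_I)
    fix r :: real assume "0 < r"
    \<comment> \<open>the two approximation errors and the error for \<open>p\<close> add up to \<open>\<epsilon> + 2 (\<epsilon> + (2 B + 1) \<epsilon> / 2)\<close>,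
      which is below \<open>\<epsilon> (2 B + 7)\<close>\<close>
    define \<epsilon> where "\<epsilon> = min 1 (r / (2 * B + 7))"
    have \<epsilon>: "0 < \<epsilon>" "\<epsilon> \<le> 1" "\<epsilon> * (2 * B + 7) \<le> r"
      using \<open>0 < r\<close> \<open>0 \<le> B\<close> by (auto simp: \<epsilon>_def min_def pos_le_divide_eq)
    obtain R where R: "measure \<nu> {x. R < norm x} < \<epsilon> / 2"
      "\<forall>\<^sub>F n in sequentially. measure (\<mu> n) {x. R < norm x} < \<epsilon> / 2"
      using characteristic_function_imp_tight[OF assms, of "\<epsilon> / 2"] \<epsilon>(1) by auto
    obtain p where p: "trig_sum p" "\<And>x. x \<in> cball 0 R \<Longrightarrow> \<bar>f x - p x\<bar> \<le> \<epsilon>" "\<And>x. \<bar>p x\<bar> \<le> B + \<epsilon>"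
      using trig_sum_approx[OF f(1) B compact_cball \<epsilon>(1)] by metis
    have approx: "\<bar>(\<integral>x. f x \<partial>M) - (\<integral>x. p x \<partial>M)\<bar> \<le> \<epsilon> + (2 * B + 1) * (\<epsilon> / 2)"
      if M: "prob_space M" "sets M = sets borel" "measure M {x. R < norm x} < \<epsilon> / 2" for M
    proof -
      interpret prob_space M by fact
      note [measurable_cong] = M(2)
      have [measurable]: "{x. R < norm x} \<in> sets M" by simp
      have ind: "integrable M (indicator {x. R < norm x} :: 'b \<Rightarrow> real)"
        by (intro integrable_real_indicator) (auto simp: less_top[symmetric])
      have "\<bar>(\<integral>x. f x \<partial>M) - (\<integral>x. p x \<partial>M)\<bar> = \<bar>\<integral>x. f x - p x \<partial>M\<bar>"
        by (simp add: Bochner_Integration.integral_diff f_int trig_sum_integrable p M)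
      also have "\<dots> \<le> (\<integral>x. \<bar>f x - p x\<bar> \<partial>M)" by simp
      also have "\<dots> \<le> (\<integral>x. \<epsilon> + (2 * B + 1) * indicator {x. R < norm x} x \<partial>M)"
      proof (rule integral_mono)
        fix x
        show "\<bar>f x - p x\<bar> \<le> \<epsilon> + (2 * B + 1) * indicator {x. R < norm x} x"
          using p(2)[of x] p(3)[of x] B[of x] \<epsilon> \<open>0 \<le> B\<close> by (cases "R < norm x") auto
      qed (use f_int[OF M(1,2)] trig_sum_integrable[OF M(1,2) p(1)] ind in
        \<open>auto intro!: integrable_abs Bochner_Integration.integrable_diff\<close>)
      also have "\<dots> = \<epsilon> + (2 * B + 1) * measure M {x. R < norm x}"
        using ind prob_space by (simp add: sets_eq_imp_space_eq[OF M(2)])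
      also have "\<dots> \<le> \<epsilon> + (2 * B + 1) * (\<epsilon> / 2)"
        using M(3) \<open>0 \<le> B\<close> by (intro add_left_mono mult_left_mono) auto
      finally show ?thesis .
    qed
    have "\<forall>\<^sub>F n in sequentially. \<bar>(\<integral>x. p x \<partial>\<mu> n) - (\<integral>x. p x \<partial>\<nu>)\<bar> < \<epsilon>"
      using tendstoD[OF tendsto_integral_trig_sum[OF assms p(1)] \<epsilon>(1)] by (simp add: dist_real_def)
    with R(2) have "\<forall>\<^sub>F n in sequentially. \<bar>(\<integral>x. f x \<partial>\<mu> n) - (\<integral>x. f x \<partial>\<nu>)\<bar> < r"
    proof eventually_elim
      case (elim n)
      have "\<epsilon> + 2 * (\<epsilon> + (2 * B + 1) * (\<epsilon> / 2)) < \<epsilon> * (2 * B + 7)"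
        using \<epsilon>(1) by (simp add: field_simps)
      moreover have "\<bar>(\<integral>x. f x \<partial>\<mu> n) - (\<integral>x. f x \<partial>\<nu>)\<bar> \<le> \<bar>(\<integral>x. f x \<partial>\<mu> n) - (\<integral>x. p x \<partial>\<mu> n)\<bar>
          + \<bar>(\<integral>x. p x \<partial>\<mu> n) - (\<integral>x. p x \<partial>\<nu>)\<bar> + \<bar>(\<integral>x. f x \<partial>\<nu>) - (\<integral>x. p x \<partial>\<nu>)\<bar>"
        by arith
      moreover have "x < r" if "x \<le> a + b + c" "a \<le> E" "b < \<epsilon>" "c \<le> E" "\<epsilon> + 2 * E < r" for x a b c E :: real
        using that by linarith
      ultimately show ?case
        using approx[OF \<mu> elim(1)] approx[OF \<nu> R(1)] elim(2) \<epsilon>(3) order.strict_trans2 by blast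
    qed
    then show "\<exists>no. \<forall>n\<ge>no. norm ((\<integral>x. f x \<partial>\<mu> n) - (\<integral>x. f x \<partial>\<nu>)) < r"
      by (simp add: eventually_sequentially)
  qed
qed

section \<open>The central limit theorem and the delta method on characteristic functions\<close>

text \<open>
  Samples are numbered from \<open>1\<close> while the one-dimensional central limit theorem numbers its summands
  from \<open>0\<close>; this moves independence along the shift.
\<close>

lemma (in prob_space) indep_vars_reindex:
  assumes "inj_on f I" and indep: "indep_vars M' X (f ` I)"
  shows "indep_vars (\<lambda>i. M' (f i)) (\<lambda>i. X (f i)) I"
  unfolding indep_vars_def2
proof (intro conjI ballI indep_setsI)
  let ?F = "\<lambda>i. {X (f i) -` A \<inter> space M |A. A \<in> sets (M' (f i))}"
  have F: "indep_sets (\<lambda>j. {X j -` A \<inter> space M |A. A \<in> sets (M' j)}) (f ` I)"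
    using indep by (simp add: indep_vars_def2)
  then show "?F i \<subseteq> events" if "i \<in> I" for i using that unfolding indep_sets_def by blast
  fix A J assume J: "J \<noteq> {}" "J \<subseteq> I" "finite J" and A: "\<forall>j\<in>J. A j \<in> ?F j"
  have inj: "inj_on f J" using assms(1) J(2) inj_on_subset by blast
  define B where "B = A \<circ> inv_into J f"
  have B: "B (f j) = A j" if "j \<in> J" for j using inj that by (simp add: B_def)
  have "prob (\<Inter>j\<in>f ` J. B j) = (\<Prod>j\<in>f ` J. prob (B j))"
    by (rule indep_setsD[OF F]) (use J A B in auto)
  then show "prob (\<Inter>j\<in>J. A j) = (\<Prod>j\<in>J. prob (A j))"
    using B by (simp add: prod.reindex[OF inj])
qed (use indep in \<open>auto simp: indep_vars_def2\<close>)

text \<open>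
  For fixed \<open>u\<close> the projections \<open>u \<bullet> (Y n - m)\<close> are independent, centered and identically distributed
  real variables with variance \<open>u \<bullet> V u\<close>, so the claim is the one-dimensional central limit theorem
  evaluated at a single frequency.
\<close>

theorem central_limit_characteristic_function:
  fixes Y :: "nat \<Rightarrow> 'a \<Rightarrow> real ^ 'd" and V :: "real ^ 'd ^ 'd"
  assumes "prob_space M"
    and indep: "prob_space.indep_vars M (\<lambda>_. borel) Y {1..}"
    and distr: "\<And>n. 1 \<le> n \<Longrightarrow> distr M borel (Y n) = \<nu>"
    and int: "\<And>u. integrable \<nu> (\<lambda>y. (u \<bullet> (y - m))\<^sup>2)"
    and mean: "\<And>u. (\<integral>y. u \<bullet> (y - m) \<partial>\<nu>) = 0"
    and var: "\<And>u. (\<integral>y. (u \<bullet> (y - m))\<^sup>2 \<partial>\<nu>) = u \<bullet> (V *v u)"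
    and pos: "\<And>u. u \<noteq> 0 \<Longrightarrow> 0 < u \<bullet> (V *v u)"
  shows "(\<lambda>N. \<integral>\<omega>. cis (u \<bullet> (sqrt (real N) *\<^sub>R (sample_mean id N (\<lambda>n. Y n \<omega>) - m))) \<partial>M)
    \<longlonglongrightarrow> complex_of_real (exp (- (u \<bullet> (V *v u)) / 2))"
proof (cases "u = 0")
  case True
  interpret prob_space M by fact
  show ?thesis using True by (simp add: prob_space)
next
  case False
  interpret prob_space M by fact
  define Z where "Z i \<omega> = u \<bullet> (Y (Suc i) \<omega> - m)" for i \<omega>
  define \<sigma> where "\<sigma> = sqrt (u \<bullet> (V *v u))"
  have \<sigma>: "0 < \<sigma>" "\<sigma>\<^sup>2 = u \<bullet> (V *v u)" using pos[OF False] by (auto simp: \<sigma>_def)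
  have Y_meas[measurable]: "Y (Suc i) \<in> borel_measurable M" for i
    using indep by (auto simp: indep_vars_def)
  have Z_meas[measurable]: "Z i \<in> borel_measurable M" for i unfolding Z_def by measurable
  have Z_distr: "(\<integral>\<omega>. f (Z i \<omega>) \<partial>M) = (\<integral>y. f (u \<bullet> (y - m)) \<partial>\<nu>)"
    if [measurable]: "f \<in> borel_measurable borel" for f :: "real \<Rightarrow> real" and i
    unfolding distr[of "Suc i", simplified, symmetric] Z_def by (subst integral_distr) auto
  have "indep_vars (\<lambda>_. borel) (\<lambda>i. Y (Suc i)) UNIV"
  proof -
    have "Suc ` UNIV = {1..}" by (auto simp: image_iff Suc_le_eq gr0_conv_Suc)
    then show ?thesis using indep_vars_reindex[of Suc UNIV "\<lambda>_. borel" Y] indep by simp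
  qed
  then have "indep_vars (\<lambda>_. borel) Z UNIV"
    unfolding Z_def by (rule indep_vars_compose2) auto
  moreover have exp0: "expectation (Z i) = 0" for i
    using Z_distr[of "\<lambda>x. x" i] mean[of u] by simp
  moreover have "integrable M (\<lambda>\<omega>. (Z i \<omega>)\<^sup>2)" for i
    using int[of u] unfolding distr[of "Suc i", simplified, symmetric] Z_def by (subst (asm) integrable_distr_eq) auto
  moreover have "variance (Z i) = \<sigma>\<^sup>2" for i
    using Z_distr[of "\<lambda>x. x\<^sup>2" i] var[of u] \<sigma>(2) by (simp add: exp0)
  moreover have "distr M borel (Z i) = distr \<nu> borel (\<lambda>y. u \<bullet> (y - m))" for i
    unfolding distr[of "Suc i", simplified, symmetric] by (subst distr_distr) (auto simp: comp_def Z_def[abs_def])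
  ultimately have "weak_conv_m (\<lambda>N. distr M borel (\<lambda>\<omega>. (\<Sum>i<N. Z i \<omega>) / sqrt (real N * \<sigma>\<^sup>2))) std_normal_distribution"
    using \<sigma>(1) by (intro central_limit_theorem_zero_mean) auto
  \<comment> \<open>the normalized sum has unit variance, so the frequency \<open>\<sigma>\<close> undoes the division by \<open>\<sigma>\<close>\<close>
  then have lim: "(\<lambda>N. char (distr M borel (\<lambda>\<omega>. (\<Sum>i<N. Z i \<omega>) / sqrt (real N * \<sigma>\<^sup>2))) \<sigma>)
      \<longlonglongrightarrow> char std_normal_distribution \<sigma>"
    by (intro levy_continuity1 real_distribution_distr) (auto intro: real_dist_normal_dist)
  have "\<sigma> * ((\<Sum>i<N. Z i \<omega>) / sqrt (real N * \<sigma>\<^sup>2))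
      = u \<bullet> (sqrt (real N) *\<^sub>R (sample_mean id N (\<lambda>n. Y n \<omega>) - m))" for N \<omega>
  proof (cases "N = 0")
    case False
    have "(\<Sum>i<N. Z i \<omega>) = u \<bullet> ((\<Sum>n = 1..N. Y n \<omega>) - real N *\<^sub>R m)"
      by (simp add: Z_def inner_diff_right sum_subtractf inner_sum_right sum.atLeast1_atMost_eq)
    also have "\<dots> = real N * (u \<bullet> (sample_mean id N (\<lambda>n. Y n \<omega>) - m))"
      using False by (simp add: sample_mean_def inner_diff_right right_diff_distrib)
    finally show ?thesis using \<sigma>(1) False
      by (simp add: real_sqrt_mult) (simp add: real_div_sqrt field_simps flip: real_sqrt_mult)
  qed simp
  then have "char (distr M borel (\<lambda>\<omega>. (\<Sum>i<N. Z i \<omega>) / sqrt (real N * \<sigma>\<^sup>2))) \<sigma>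
      = (\<integral>\<omega>. cis (u \<bullet> (sqrt (real N) *\<^sub>R (sample_mean id N (\<lambda>n. Y n \<omega>) - m))) \<partial>M)" for N
    unfolding char_def by (subst integral_distr) (auto simp: cis_conv_exp simp flip: of_real_mult)
  then show ?thesis using lim by (simp add: char_std_normal_distribution \<sigma>(2))
qed

lemma cis_lipschitz: "cmod (cis a - cis b) \<le> \<bar>a - b\<bar>"
proof -
  have "cis a - cis b = cis b * (cis (a - b) - 1)"
    by (simp add: right_diff_distrib cis_mult)
  then have "cmod (cis a - cis b) = cmod (cis (a - b) - 1)"
    by (simp add: norm_mult)
  also have "\<dots> \<le> \<bar>a - b\<bar>"
    using iexp_approx1[of "a - b" 0] by (simp add: cis_conv_exp)
  finally show ?thesis .
qed

text \<open>
  A bounded \<open>S N\<close> divided by \<open>sqrt N\<close> eventually falls below any \<open>\<delta>\<close>. In the two results that follow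
  this puts \<open>m + S N / sqrt N\<close> into a neighbourhood of \<open>m\<close> on an event of large probability.
\<close>

lemma rescaled_near:
  fixes S :: "nat \<Rightarrow> 'a \<Rightarrow> 'b::real_normed_vector"
  assumes "0 < \<delta>"
  shows "\<forall>\<^sub>F N in sequentially. 1 \<le> N \<and> (\<forall>\<omega>. norm (S N \<omega>) \<le> R \<longrightarrow> norm (S N \<omega> /\<^sub>R sqrt (real N)) < \<delta>)"
proof -
  have "\<forall>\<^sub>F N in sequentially. R / \<delta> < sqrt (real N)"
    using filterlim_compose[OF sqrt_at_top filterlim_real_sequentially]
    by (simp add: filterlim_at_top_dense)
  with eventually_ge_at_top[of 1] show ?thesis
  proof eventually_elim
    case (elim N)
    then have "R < \<delta> * sqrt (real N)" using assms by (simp add: field_simps)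
    then show ?case using elim by (auto simp: divide_simps mult.commute)
  qed
qed

lemma tight_rescaled_prob_tendsto_1:
  fixes S :: "nat \<Rightarrow> 'a \<Rightarrow> 'b::euclidean_space"
  assumes "prob_space M" and [measurable]: "\<And>N. S N \<in> borel_measurable M"
    and tight: "\<And>\<epsilon>. 0 < \<epsilon> \<Longrightarrow> \<exists>R. \<forall>\<^sub>F N in sequentially. measure M {\<omega> \<in> space M. R < norm (S N \<omega>)} < \<epsilon>"
    and U: "open U" "m \<in> U"
  shows "(\<lambda>N. measure M {\<omega> \<in> space M. m + S N \<omega> /\<^sub>R sqrt (real N) \<in> U}) \<longlonglongrightarrow> 1"
proof (rule LIMSEQ_I)
  interpret prob_space M by fact
  have [measurable]: "U \<in> sets borel" using U by simp
  fix r :: real assume "0 < r"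
  obtain R where R: "\<forall>\<^sub>F N in sequentially. prob {\<omega> \<in> space M. R < norm (S N \<omega>)} < r"
    using tight[OF \<open>0 < r\<close>] by blast
  obtain \<delta> where \<delta>: "0 < \<delta>" "ball m \<delta> \<subseteq> U" using openE[OF U] by blast
  have "\<forall>\<^sub>F N in sequentially. \<bar>prob {\<omega> \<in> space M. m + S N \<omega> /\<^sub>R sqrt (real N) \<in> U} - 1\<bar> < r"
    using R rescaled_near[OF \<delta>(1), of S R]
  proof eventually_elim
    case (elim N)
    let ?E = "{\<omega> \<in> space M. m + S N \<omega> /\<^sub>R sqrt (real N) \<in> U}"
    have "space M - ?E \<subseteq> {\<omega> \<in> space M. R < norm (S N \<omega>)}"
    proof
      fix \<omega> assume \<omega>: "\<omega> \<in> space M - ?E"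
      have "R < norm (S N \<omega>)"
      proof (rule ccontr)
        assume "\<not> ?thesis"
        then have "m + S N \<omega> /\<^sub>R sqrt (real N) \<in> ball m \<delta>" using elim(2) by (simp add: dist_norm)
        then show False using \<delta>(2) \<omega> by blast
      qed
      then show "\<omega> \<in> {\<omega> \<in> space M. R < norm (S N \<omega>)}" using \<omega> by simp
    qed
    then have "prob (space M - ?E) \<le> prob {\<omega> \<in> space M. R < norm (S N \<omega>)}"
      by (intro finite_measure_mono) measurable
    then show ?case using elim(1) prob_le_1[of ?E] by (simp add: prob_compl)
  qed
  then show "\<exists>no. \<forall>N\<ge>no. norm (prob {\<omega> \<in> space M. m + S N \<omega> /\<^sub>R sqrt (real N) \<in> U} - 1) < r"
    by (simp add: eventually_sequentially)
qed

text \<open>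
  On the event \<open>norm (S N) \<le> R\<close>, of probability close to \<open>1\<close> by tightness, differentiability of \<open>g\<close>
  makes \<open>T N - G (S N)\<close> uniformly small, and \<open>t \<mapsto> exp (i t)\<close> is Lipschitz; off that event the two
  integrands differ by at most \<open>2\<close>. The exact formula for \<open>T N\<close> is only required almost surely and
  near \<open>m\<close>, which leaves room for estimators that may fail to exist.
\<close>

theorem delta_method_characteristic_function:
  fixes S :: "nat \<Rightarrow> 'a \<Rightarrow> 'b::euclidean_space" and T :: "nat \<Rightarrow> 'a \<Rightarrow> 'c::euclidean_space"
  assumes "prob_space M" and S[measurable]: "\<And>N. S N \<in> borel_measurable M"
    and T: "\<And>N. 1 \<le> N \<Longrightarrow> T N \<in> borel_measurable M"
    and tight: "\<And>\<epsilon>. 0 < \<epsilon> \<Longrightarrow> \<exists>R. \<forall>\<^sub>F N in sequentially. measure M {\<omega> \<in> space M. R < norm (S N \<omega>)} < \<epsilon>"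
    and U: "open U" "m \<in> U"
    and T_eq: "\<And>N. 1 \<le> N \<Longrightarrow> AE \<omega> in M. m + S N \<omega> /\<^sub>R sqrt (real N) \<in> U \<longrightarrow>
      T N \<omega> = sqrt (real N) *\<^sub>R (g (m + S N \<omega> /\<^sub>R sqrt (real N)) - g m)"
    and g: "(g has_derivative G) (at m)"
    and lim: "(\<lambda>N. \<integral>\<omega>. cis (u \<bullet> G (S N \<omega>)) \<partial>M) \<longlonglongrightarrow> l"
  shows "(\<lambda>N. \<integral>\<omega>. cis (u \<bullet> T N \<omega>) \<partial>M) \<longlonglongrightarrow> l"
proof -
  interpret prob_space M by fact
  have G: "bounded_linear G" using g by (rule has_derivative_bounded_linear)
  have [measurable]: "G \<in> borel_measurable borel"
    using borel_measurable_continuous_onI[OF linear_continuous_on[OF G]] .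
  have "(\<lambda>N. (\<integral>\<omega>. cis (u \<bullet> T N \<omega>) \<partial>M) - (\<integral>\<omega>. cis (u \<bullet> G (S N \<omega>)) \<partial>M)) \<longlonglongrightarrow> 0"
  proof (rule LIMSEQ_I)
    fix r :: real assume "0 < r"
    define \<epsilon> where "\<epsilon> = r / 4"
    have "0 < \<epsilon>" using \<open>0 < r\<close> by (simp add: \<epsilon>_def)
    obtain R0 where R0: "\<forall>\<^sub>F N in sequentially. prob {\<omega> \<in> space M. R0 < norm (S N \<omega>)} < \<epsilon>"
      using tight[OF \<open>0 < \<epsilon>\<close>] by blast
    define R where "R = max R0 1"
    have "0 < R" by (simp add: R_def)
    \<comment> \<open>chosen so that a derivative error of \<open>\<eta>\<close> per unit of \<open>norm (S N) \<le> R\<close> moves the phase by at most \<open>\<epsilon>\<close>;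
      adding \<open>1\<close> avoids a division by zero for \<open>u = 0\<close>\<close>
    define \<eta> where "\<eta> = \<epsilon> / ((norm u + 1) * R)"
    have "0 < \<eta>" using \<open>0 < \<epsilon>\<close> \<open>0 < R\<close> by (simp add: \<eta>_def add_nonneg_pos)
    have \<eta>: "norm u * (\<eta> * R) \<le> \<epsilon>"
    proof -
      have "norm u * (\<eta> * R) = \<epsilon> * (norm u / (norm u + 1))"
        using \<open>0 < R\<close> by (simp add: \<eta>_def)
      also have "\<dots> \<le> \<epsilon> * 1"
        using \<open>0 < \<epsilon>\<close> by (intro mult_left_mono) (auto simp: divide_le_eq_1 add_nonneg_pos)
      finally show ?thesis by simp
    qed
    obtain \<delta>1 where \<delta>1: "0 < \<delta>1" "\<And>y. norm (y - m) < \<delta>1 \<Longrightarrow> norm (g y - g m - G (y - m)) \<le> \<eta> * norm (y - m)"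
      using g \<open>0 < \<eta>\<close> unfolding has_derivative_at_alt by blast
    obtain \<delta>2 where \<delta>2: "0 < \<delta>2" "ball m \<delta>2 \<subseteq> U" using openE[OF U] by blast
    have "\<forall>\<^sub>F N in sequentially. norm ((\<integral>\<omega>. cis (u \<bullet> T N \<omega>) \<partial>M) - (\<integral>\<omega>. cis (u \<bullet> G (S N \<omega>)) \<partial>M)) < r"
      using R0 rescaled_near[of "min \<delta>1 \<delta>2" S R, OF min_less_iff_conj[THEN iffD2, OF conjI[OF \<delta>1(1) \<delta>2(1)]]]
    proof eventually_elim
      case (elim N)
      then have "1 \<le> N" by blast
      note [measurable] = T[OF \<open>1 \<le> N\<close>]
      have close: "norm (T N \<omega> - G (S N \<omega>)) \<le> \<eta> * R"
        if "norm (S N \<omega>) \<le> R" and eq: "m + S N \<omega> /\<^sub>R sqrt (real N) \<in> U \<longrightarrow>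
          T N \<omega> = sqrt (real N) *\<^sub>R (g (m + S N \<omega> /\<^sub>R sqrt (real N)) - g m)" for \<omega>
      proof -
        let ?h = "S N \<omega> /\<^sub>R sqrt (real N)"
        have small: "norm ?h < \<delta>1" "norm ?h < \<delta>2" using elim(2) that(1) by auto
        have "m + ?h \<in> U" using small(2) \<delta>2(2) by (auto simp: dist_norm subset_iff)
        moreover have "G (S N \<omega>) = sqrt (real N) *\<^sub>R G ?h"
          using \<open>1 \<le> N\<close> by (simp add: linear_cmul[OF bounded_linear.linear[OF G]])
        ultimately have "T N \<omega> - G (S N \<omega>) = sqrt (real N) *\<^sub>R (g (m + ?h) - g m - G ?h)"
          using eq by (simp add: scaleR_diff_right)
        then have "norm (T N \<omega> - G (S N \<omega>)) = sqrt (real N) * norm (g (m + ?h) - g m - G ?h)"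
          by simp
        also have "\<dots> \<le> sqrt (real N) * (\<eta> * norm ?h)"
          using \<delta>1(2)[of "m + ?h"] small(1) by (intro mult_left_mono) auto
        also have "\<dots> = \<eta> * norm (S N \<omega>)" using \<open>1 \<le> N\<close> by simp
        also have "\<dots> \<le> \<eta> * R" using that(1) \<open>0 < \<eta>\<close> by simp
        finally show ?thesis .
      qed
      have int: "integrable M (\<lambda>\<omega>. cis (u \<bullet> T N \<omega>))" "integrable M (\<lambda>\<omega>. cis (u \<bullet> G (S N \<omega>)))"
        by (rule integrable_const_bound[of _ 1]; simp add: cis_conv_exp)+
      have "norm ((\<integral>\<omega>. cis (u \<bullet> T N \<omega>) \<partial>M) - (\<integral>\<omega>. cis (u \<bullet> G (S N \<omega>)) \<partial>M))
          = norm (\<integral>\<omega>. cis (u \<bullet> T N \<omega>) - cis (u \<bullet> G (S N \<omega>)) \<partial>M)"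
        using int by simp
      also have "\<dots> \<le> (\<integral>\<omega>. norm (cis (u \<bullet> T N \<omega>) - cis (u \<bullet> G (S N \<omega>))) \<partial>M)"
        by (rule integral_norm_bound)
      also have "\<dots> \<le> (\<integral>\<omega>. \<epsilon> + 2 * indicator {\<omega> \<in> space M. R0 < norm (S N \<omega>)} \<omega> \<partial>M)"
      proof (rule integral_mono_AE)
        show "AE \<omega> in M. norm (cis (u \<bullet> T N \<omega>) - cis (u \<bullet> G (S N \<omega>)))
            \<le> \<epsilon> + 2 * indicator {\<omega> \<in> space M. R0 < norm (S N \<omega>)} \<omega>"
          using T_eq[OF \<open>1 \<le> N\<close>] AE_space
        proof eventually_elim
          case (elim \<omega>)
          show ?case
          proof (cases "R0 < norm (S N \<omega>)")
            case True
            have "norm (cis (u \<bullet> T N \<omega>) - cis (u \<bullet> G (S N \<omega>))) \<le> 1 + 1"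
              by (rule norm_triangle_le_diff) simp
            then show ?thesis using True elim(2) \<open>0 < \<epsilon>\<close> by simp
          next
            case False
            have "norm (cis (u \<bullet> T N \<omega>) - cis (u \<bullet> G (S N \<omega>))) \<le> \<bar>u \<bullet> (T N \<omega> - G (S N \<omega>))\<bar>"
              using cis_lipschitz by (simp add: inner_diff_right)
            also have "\<dots> \<le> norm u * norm (T N \<omega> - G (S N \<omega>))" by (rule Cauchy_Schwarz_ineq2)
            also have "\<dots> \<le> norm u * (\<eta> * R)"
              using False elim(1) by (intro mult_left_mono close) (auto simp: R_def)
            finally show ?thesis using False \<eta> by simp
          qed
        qed
      qed (use int in \<open>auto intro!: integrable_norm Bochner_Integration.integrable_diff
          integrable_real_indicator simp: less_top[symmetric]\<close>)
      also have "\<dots> = \<epsilon> + 2 * prob {\<omega> \<in> space M. R0 < norm (S N \<omega>)}"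
        by (subst Bochner_Integration.integral_add) (auto simp: prob_space less_top[symmetric] intro!: integrable_real_indicator)
      also have "\<dots> < r" using elim(1) \<open>0 < r\<close> by (simp add: \<epsilon>_def)
      finally show ?case .
    qed
    then show "\<exists>no. \<forall>N\<ge>no. norm ((\<integral>\<omega>. cis (u \<bullet> T N \<omega>) \<partial>M) - (\<integral>\<omega>. cis (u \<bullet> G (S N \<omega>)) \<partial>M) - 0) < r"
      by (simp add: eventually_sequentially)
  qed
  from tendsto_add[OF this lim] show ?thesis by simp
qed

section \<open>Characteristic functions of centered normal laws\<close>

lemma axis_one_bij_Basis: "bij_betw (\<lambda>i. axis i 1) UNIV (Basis :: (real ^ 'd) set)"
  by (auto simp: bij_betw_def inj_on_def Basis_vec_def axis_eq_axis)

lemma prod_coordinates: "(\<Prod>i\<in>UNIV. f (z $ i)) = (\<Prod>b\<in>Basis. f (z \<bullet> b))" for z :: "real ^ 'd"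
  by (subst prod.reindex_bij_betw[OF axis_one_bij_Basis, symmetric]) (simp add: inner_axis)

lemma
  fixes h :: "'b::euclidean_space \<Rightarrow> real \<Rightarrow> complex"
  assumes h: "\<And>b. b \<in> Basis \<Longrightarrow> integrable lborel (h b)"
  shows integrable_lborel_prod: "integrable lborel (\<lambda>z. \<Prod>b\<in>Basis. h b (z \<bullet> b))"
    and integral_lborel_prod: "(\<integral>z. (\<Prod>b\<in>Basis. h b (z \<bullet> b)) \<partial>lborel) = (\<Prod>b\<in>Basis. \<integral>t. h b t \<partial>lborel)"
proof -
  interpret product_sigma_finite "\<lambda>_::'b. lborel :: real measure" by standard
  have [measurable]: "h b \<in> borel_measurable borel" if "b \<in> Basis" for b
    using borel_measurable_integrable[OF h[OF that]] by simp
  have coord: "(\<Sum>b'\<in>Basis. f b' *\<^sub>R b') \<bullet> b = f b" if "b \<in> Basis" for f and b :: 'b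
    using that by simp
  have eq: "(\<lambda>f. \<Prod>b\<in>Basis. h b ((\<Sum>b'\<in>Basis. f b' *\<^sub>R b') \<bullet> b)) = (\<lambda>f. \<Prod>b\<in>Basis. h b (f b))"
    by (intro ext prod.cong refl) (simp add: coord)
  have meas: "(\<lambda>f. \<Sum>b\<in>Basis. f b *\<^sub>R b) \<in> measurable (\<Pi>\<^sub>M b\<in>(Basis::'b set). lborel) (borel :: 'b measure)"
    by measurable
  have meas': "(\<lambda>z. \<Prod>b\<in>Basis. h b (z \<bullet> b)) \<in> borel_measurable (borel :: 'b measure)"
    by measurable
  show "integrable lborel (\<lambda>z. \<Prod>b\<in>Basis. h b (z \<bullet> b))"
    unfolding lborel_eq[where 'a = 'b]
    by (subst integrable_distr_eq[OF meas meas']) (use h in \<open>simp only: eq, intro product_integrable_prod; auto\<close>)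
  show "(\<integral>z. (\<Prod>b\<in>Basis. h b (z \<bullet> b)) \<partial>lborel) = (\<Prod>b\<in>Basis. \<integral>t. h b t \<partial>lborel)"
    unfolding lborel_eq[where 'a = 'b]
    by (subst integral_distr[OF meas meas']) (use h in \<open>simp only: eq, intro product_integral_prod; auto\<close>)
qed

text \<open>
  Both the density and the wave factor over the coordinates, so the integral is a product of
  one-dimensional characteristic functions.
\<close>

lemma std_normal_vec_wave:
  fixes u :: "real ^ 'd"
  shows "has_bochner_integral lborel (\<lambda>z. (\<Prod>i\<in>UNIV. std_normal_density (z $ i)) *\<^sub>R cis (u \<bullet> z))
    (exp (- (u \<bullet> u) / 2))"
proof -
  define h where "h b t = std_normal_density t *\<^sub>R cis ((u \<bullet> b) * t)" for b t
  have dens: "integrable lborel (std_normal_density :: real \<Rightarrow> real)" by simp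
  have int: "integrable lborel (h b)" for b
    by (rule Bochner_Integration.integrable_bound[OF dens]) (auto simp: h_def[abs_def] cis_conv_exp)
  have val: "(\<integral>t. h b t \<partial>lborel) = complex_of_real (exp (- (u \<bullet> b)\<^sup>2 / 2))" for b
  proof -
    have "complex_of_real (exp (- (u \<bullet> b)\<^sup>2 / 2)) = char std_normal_distribution (u \<bullet> b)"
      by (simp add: char_std_normal_distribution)
    also have "\<dots> = (\<integral>t. h b t \<partial>lborel)"
      unfolding char_def h_def by (subst integral_density) (auto simp: cis_conv_exp)
    finally show ?thesis by simp
  qed
  have prod: "(\<Prod>i\<in>UNIV. std_normal_density (z $ i)) *\<^sub>R cis (u \<bullet> z) = (\<Prod>b\<in>Basis. h b (z \<bullet> b))" for z
  proof -
    have "cis (u \<bullet> z) = (\<Prod>b\<in>Basis. cis ((u \<bullet> b) * (z \<bullet> b)))"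
      unfolding cis_conv_exp by (subst euclidean_inner) (simp add: exp_sum sum_distrib_left)
    then show ?thesis
      by (simp add: h_def prod_coordinates scaleR_conv_of_real prod.distrib)
  qed
  have "(\<Prod>b\<in>Basis. complex_of_real (exp (- (u \<bullet> b)\<^sup>2 / 2))) = of_real (exp (\<Sum>b\<in>Basis. - (u \<bullet> b)\<^sup>2 / 2))"
    by (simp add: exp_sum)
  also have "(\<Sum>b\<in>Basis. - (u \<bullet> b)\<^sup>2 / 2) = - (u \<bullet> u) / 2"
    by (subst euclidean_inner) (simp add: sum_negf sum_divide_distrib power2_eq_square)
  finally show ?thesis
    unfolding has_bochner_integral_iff prod
    using integrable_lborel_prod[of h, OF int] integral_lborel_prod[of h, OF int] val by simp
qed

lemma std_normal_vec_density_measurable[measurable]: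
  "(\<lambda>z :: real ^ 'd. \<Prod>i\<in>UNIV. std_normal_density (z $ i)) \<in> borel_measurable borel"
  unfolding prod_coordinates by measurable

text \<open>
  The total mass is the characteristic function at \<open>0\<close>.
\<close>

lemma prob_space_std_normal_vec: "prob_space (std_normal_vec :: (real ^ 'd) measure)"
proof
  let ?\<phi> = "\<lambda>z :: real ^ 'd. \<Prod>i\<in>UNIV. std_normal_density (z $ i)"
  have pos: "0 \<le> ?\<phi> z" for z by (intro prod_nonneg) auto
  have "has_bochner_integral lborel (\<lambda>z. complex_of_real (?\<phi> z)) (of_real 1)"
    using std_normal_vec_wave[of 0] by (simp add: scaleR_conv_of_real)
  then have "has_bochner_integral lborel ?\<phi> 1"
    by (simp add: has_bochner_integral_iff complex_of_real_integrable_eq flip: of_real_prod)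
  then have "(\<integral>\<^sup>+z. ennreal (?\<phi> z) \<partial>lborel) = ennreal 1"
    using pos by (simp add: has_bochner_integral_iff nn_integral_eq_integral)
  then show "emeasure (std_normal_vec :: (real ^ 'd) measure) (space std_normal_vec) = 1"
    unfolding std_normal_vec_def by (subst emeasure_density) auto
qed

lemma characteristic_function_std_normal_vec:
  "(\<integral>z. cis (u \<bullet> z) \<partial>std_normal_vec) = complex_of_real (exp (- (u \<bullet> u) / 2))" for u :: "real ^ 'd"
  using std_normal_vec_wave[of u] unfolding std_normal_vec_def
  by (subst integral_density) (auto simp: has_bochner_integral_iff cis_conv_exp intro!: prod_nonneg)

lemma
  fixes A :: "real ^ 'd ^ 'd"
  shows prob_space_normal: "prob_space (distr std_normal_vec borel ((*v) A))"
    and characteristic_function_normal: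
      "(\<integral>z. cis (u \<bullet> z) \<partial>distr std_normal_vec borel ((*v) A)) = complex_of_real (exp (- (u \<bullet> ((A ** transpose A) *v u)) / 2))"
proof -
  interpret prob_space "std_normal_vec :: (real ^ 'd) measure" by (rule prob_space_std_normal_vec)
  have [measurable]: "(*v) A \<in> borel_measurable std_normal_vec"
    using borel_measurable_continuous_onI[OF linear_continuous_on[OF matrix_vector_mul_bounded_linear]]
    by (simp add: std_normal_vec_def measurable_def)
  show "prob_space (distr std_normal_vec borel ((*v) A))" by (rule prob_space_distr) simp
  have "(\<integral>z. cis (u \<bullet> z) \<partial>distr std_normal_vec borel ((*v) A)) = (\<integral>z. cis ((transpose A *v u) \<bullet> z) \<partial>std_normal_vec)"
    by (subst integral_distr) (auto simp: cis_conv_exp dot_lmul_matrix vector_transpose_matrix)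
  also have "\<dots> = complex_of_real (exp (- (u \<bullet> ((A ** transpose A) *v u)) / 2))"
    unfolding characteristic_function_std_normal_vec
    by (simp add: matrix_vector_mul_assoc[symmetric] dot_lmul_matrix)
  finally show "(\<integral>z. cis (u \<bullet> z) \<partial>distr std_normal_vec borel ((*v) A))
     = complex_of_real (exp (- (u \<bullet> ((A ** transpose A) *v u)) / 2))" .
qed

section \<open>Moments from the moment generating function\<close>

lemma abs_power_le_fact_exp:
  fixes y r :: real assumes "0 \<le> r"
  shows "\<bar>y\<bar> ^ n * r ^ n / fact n \<le> exp (r * y) + exp (- r * y)"
proof -
  have "(r * \<bar>y\<bar>) ^ n /\<^sub>R fact n \<le> exp (r * \<bar>y\<bar>)"
  proof -
    have s: "(\<lambda>n. (r * \<bar>y\<bar>) ^ n /\<^sub>R fact n) sums exp (r * \<bar>y\<bar>)" by (rule exp_converges)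
    have "(\<Sum>k\<in>{n}. (r * \<bar>y\<bar>) ^ k /\<^sub>R fact k) \<le> (\<Sum>k. (r * \<bar>y\<bar>) ^ k /\<^sub>R fact k)"
      using assms by (intro sum_le_suminf sums_summable[OF s]) auto
    then show ?thesis using sums_unique[OF s] by simp
  qed
  also have "\<dots> \<le> exp (r * y) + exp (- r * y)" by (cases "0 \<le> y") auto
  finally show ?thesis by (simp add: power_mult_distrib divide_inverse mult_ac)
qed

text \<open>
  Expanding \<open>exp (t Y)\<close> and integrating termwise shows that the moment generating function is the
  power series with coefficients \<open>E (Y ^ n) / n!\<close> near \<open>0\<close>. A power series is differentiated
  termwise, so the derivatives of any closed form \<open>F\<close> at \<open>0\<close> give the moments.
\<close>

lemma moments_from_mgf:
  fixes Y :: "'a \<Rightarrow> real"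
  assumes "prob_space M" and Y[measurable]: "Y \<in> borel_measurable M" and "0 < \<epsilon>"
    and int: "\<And>t. \<bar>t\<bar> < \<epsilon> \<Longrightarrow> integrable M (\<lambda>x. exp (t * Y x))"
    and F: "\<And>t. \<bar>t\<bar> < \<epsilon> \<Longrightarrow> (\<integral>x. exp (t * Y x) \<partial>M) = F t"
    and F': "\<And>t. \<bar>t\<bar> < \<epsilon> \<Longrightarrow> (F has_real_derivative F' t) (at t)"
    and F'': "(F' has_real_derivative F'') (at 0)"
  shows "integrable M (\<lambda>x. (Y x)\<^sup>2)" "(\<integral>x. Y x \<partial>M) = F' 0" "(\<integral>x. (Y x)\<^sup>2 \<partial>M) = F''"
proof -
  interpret prob_space M by fact
  have int_pow: "integrable M (\<lambda>x. Y x ^ n)" for n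
  proof -
    define r where "r = \<epsilon> / 2"
    have r: "0 < r" "\<bar>r\<bar> < \<epsilon>" "\<bar>- r\<bar> < \<epsilon>" using \<open>0 < \<epsilon>\<close> by (auto simp: r_def)
    have "integrable M (\<lambda>x. fact n / r ^ n * (exp (r * Y x) + exp (- r * Y x)))"
      by (intro integrable_mult_right Bochner_Integration.integrable_add int r)
    then show ?thesis
    proof (rule Bochner_Integration.integrable_bound)
      show "AE x in M. norm (Y x ^ n) \<le> norm (fact n / r ^ n * (exp (r * Y x) + exp (- r * Y x)))"
      proof (rule AE_I2)
        fix x
        have "\<bar>Y x\<bar> ^ n = fact n / r ^ n * (\<bar>Y x\<bar> ^ n * r ^ n / fact n)" using r by simp
        also have "\<dots> \<le> fact n / r ^ n * (exp (r * Y x) + exp (- r * Y x))"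
          using r by (intro mult_left_mono abs_power_le_fact_exp) auto
        finally show "norm (Y x ^ n) \<le> norm (fact n / r ^ n * (exp (r * Y x) + exp (- r * Y x)))"
          using r by (simp add: power_abs abs_mult)
      qed
    qed simp
  qed
  define c where "c n = (\<integral>x. Y x ^ n \<partial>M) / fact n" for n
  have sums: "(\<lambda>n. c n * t ^ n) sums F t" if t: "\<bar>t\<bar> < \<epsilon>" for t
  proof -
    have e: "(\<lambda>n. Y x ^ n * t ^ n / fact n) sums exp (t * Y x)" for x
      using exp_converges[of "t * Y x"] by (simp add: power_mult_distrib divide_inverse mult_ac)
    have n: "(\<lambda>n. norm (Y x ^ n * t ^ n / fact n)) sums exp (\<bar>t\<bar> * \<bar>Y x\<bar>)" for x
      using exp_converges[of "\<bar>t\<bar> * \<bar>Y x\<bar>"]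
      by (simp add: power_mult_distrib divide_inverse mult_ac abs_mult power_abs)
    \<comment> \<open>the sum of the absolute values of the terms is \<open>exp (\<bar>t\<bar> \<bar>Y\<bar>)\<close>, which justifies the exchange\<close>
    have bound: "integrable M (\<lambda>x. exp (\<bar>t\<bar> * \<bar>Y x\<bar>))"
    proof (rule Bochner_Integration.integrable_bound)
      show "integrable M (\<lambda>x. exp (t * Y x) + exp (- t * Y x))"
        using t by (intro Bochner_Integration.integrable_add int) auto
      have "\<bar>t\<bar> * \<bar>y\<bar> = t * y \<or> \<bar>t\<bar> * \<bar>y\<bar> = - t * y" for y :: real
        by (auto simp: abs_if)
      then have "exp (\<bar>t\<bar> * \<bar>y\<bar>) \<le> exp (t * y) + exp (- t * y)" for y :: real
        by (smt (verit) exp_ge_zero)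
      then show "AE x in M. norm (exp (\<bar>t\<bar> * \<bar>Y x\<bar>)) \<le> norm (exp (t * Y x) + exp (- t * Y x))"
        by (intro AE_I2) (smt (verit) exp_ge_zero real_norm_def)
    qed simp
    have i: "integrable M (\<lambda>x. Y x ^ n * t ^ n / fact n)" for n
      using int_pow[of n] by simp
    have "summable (\<lambda>n. \<integral>x. norm (Y x ^ n * t ^ n / fact n) \<partial>M)"
    proof (rule summableI_nonneg_bounded)
      fix n
      have "(\<Sum>k<n. \<integral>x. norm (Y x ^ k * t ^ k / fact k) \<partial>M)
          = (\<integral>x. (\<Sum>k<n. norm (Y x ^ k * t ^ k / fact k)) \<partial>M)"
        using i by (intro Bochner_Integration.integral_sum[symmetric] integrable_norm)
      also have "\<dots> \<le> (\<integral>x. exp (\<bar>t\<bar> * \<bar>Y x\<bar>) \<partial>M)"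
      proof (rule integral_mono)
        fix x
        show "(\<Sum>k<n. norm (Y x ^ k * t ^ k / fact k)) \<le> exp (\<bar>t\<bar> * \<bar>Y x\<bar>)"
          unfolding sums_unique[OF n[of x]] by (intro sum_le_suminf sums_summable[OF n]) auto
      qed (use i bound in \<open>auto intro!: Bochner_Integration.integrable_sum integrable_norm simp del: real_norm_def\<close>)
      finally show "(\<Sum>k<n. \<integral>x. norm (Y x ^ k * t ^ k / fact k) \<partial>M) \<le> (\<integral>x. exp (\<bar>t\<bar> * \<bar>Y x\<bar>) \<partial>M)" .
    qed (simp add: integral_nonneg_AE)
    then have "(\<lambda>n. \<integral>x. Y x ^ n * t ^ n / fact n \<partial>M) sums (\<integral>x. (\<Sum>n. Y x ^ n * t ^ n / fact n) \<partial>M)"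
      using sums_summable[OF n] by (intro sums_integral i) auto
    also have "(\<integral>x. (\<Sum>n. Y x ^ n * t ^ n / fact n) \<partial>M) = F t"
      by (simp add: sums_unique[OF e, symmetric] F t)
    finally show ?thesis by (simp add: c_def)
  qed
  have sums': "(\<lambda>n. diffs c n * t ^ n) sums F' t" if t: "\<bar>t\<bar> < \<epsilon>" for t
    by (rule termdiffs_sums_strong[where K = \<epsilon> and f = F]) (use sums F' t in auto)
  have sums'': "(\<lambda>n. diffs (diffs c) n * 0 ^ n) sums F''"
    by (rule termdiffs_sums_strong[where K = \<epsilon> and f = F']) (use sums' F'' \<open>0 < \<epsilon>\<close> in auto)
  show "integrable M (\<lambda>x. (Y x)\<^sup>2)" by (rule int_pow)
  have "(\<lambda>n. diffs c n * 0 ^ n) sums diffs c 0" by (rule powser_sums_zero)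
  then have "diffs c 0 = F' 0" using sums'[of 0] \<open>0 < \<epsilon>\<close> sums_unique2 by force
  then show "(\<integral>x. Y x \<partial>M) = F' 0" by (simp add: diffs_def c_def)
  have "(\<lambda>n. diffs (diffs c) n * 0 ^ n) sums diffs (diffs c) 0" by (rule powser_sums_zero)
  then have "diffs (diffs c) 0 = F''" using sums'' sums_unique2 by blast
  then show "(\<integral>x. (Y x)\<^sup>2 \<partial>M) = F''" by (simp add: diffs_def c_def numeral_2_eq_2)
qed

section \<open>Vectors and matrices\<close>

lemma measurable_vec_lambda:
  fixes f :: "'a \<Rightarrow> real ^ 'n"
  assumes "\<And>i. (\<lambda>x. f x $ i) \<in> borel_measurable M"
  shows "f \<in> borel_measurable M"
proof (subst borel_measurable_euclidean_space, intro ballI)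
  fix b :: "real ^ 'n" assume "b \<in> Basis"
  then obtain i where "b = axis i 1" by (auto simp: Basis_vec_def)
  then show "(\<lambda>x. f x \<bullet> b) \<in> borel_measurable M" using assms[of i] by (simp add: inner_axis)
qed

lemma integrable_vec:
  fixes f :: "'a \<Rightarrow> real ^ 'n"
  assumes "\<And>i. integrable M (\<lambda>x. f x $ i)"
  shows "integrable M f"
proof -
  have "f x = (\<Sum>i\<in>UNIV. (f x $ i) *\<^sub>R axis i 1)" for x
    by (simp add: vec_eq_iff axis_def if_distrib cong: if_cong)
  then have "integrable M f \<longleftrightarrow> integrable M (\<lambda>x. \<Sum>i\<in>UNIV. (f x $ i) *\<^sub>R (axis i 1 :: real ^ 'n))"
    by presburger
  then show ?thesis using assms by auto
qed

lemma
  fixes A :: "real ^ 'n ^ 'n"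
  assumes "invertible A"
  shows matrix_inv_right: "A ** matrix_inv A = mat 1" and matrix_inv_left: "matrix_inv A ** A = mat 1"
  using assms someI_ex[of "\<lambda>B. A ** B = mat 1 \<and> B ** A = mat 1"]
  unfolding invertible_def matrix_inv_def by blast+

lemma matrix_inv_unique:
  fixes A :: "real ^ 'n ^ 'n"
  assumes "A ** B = mat 1"
  shows "matrix_inv A = B"
proof -
  have "invertible A" using assms invertible_right_inverse by blast
  then show ?thesis
    by (metis assms matrix_inv_left matrix_mul_assoc matrix_mul_lid matrix_mul_rid)
qed

text \<open>
  A diagonal matrix minus a multiple of the all-ones matrix has the inverse
  \<open>D\<^sup>-\<^sup>1 + \<gamma> D\<^sup>-\<^sup>1 1 1\<^sup>T D\<^sup>-\<^sup>1\<close> (Sherman-Morrison). With \<open>w = D\<^sup>-\<^sup>1\<^sup>/\<^sup>2 1\<close> this is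
  \<open>D\<^sup>-\<^sup>1\<^sup>/\<^sup>2 (I + \<gamma> w w\<^sup>T) D\<^sup>-\<^sup>1\<^sup>/\<^sup>2\<close>, and \<open>I + \<gamma> w w\<^sup>T\<close> is the square of the symmetric matrix
  \<open>I + \<sigma> w w\<^sup>T\<close> for a suitable \<open>\<sigma>\<close>. This exhibits the factor that a normal law with this covariance
  requires.
\<close>

lemma factor_of_inverse_information:
  fixes d :: "'k::finite \<Rightarrow> real" and c :: real
  defines "J \<equiv> (\<chi> i j. (if i = j then d i else 0) - c) :: real ^ 'k ^ 'k"
  assumes d: "\<And>i. 0 < d i" and pos: "\<And>u. u \<noteq> 0 \<Longrightarrow> 0 < u \<bullet> (J *v u)"
  obtains A :: "real ^ 'k ^ 'k" where "A ** transpose A = matrix_inv J"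
proof -
  define s where "s = (\<Sum>i\<in>UNIV. 1 / d i)"
  define D where "D = 1 - c * s"
  have s: "0 < s" unfolding s_def using d by (intro sum_pos) auto
  have D: "0 < D"
  proof -
    \<comment> \<open>testing positivity on \<open>D\<^sup>-\<^sup>1 1\<close> gives \<open>s (1 - c s) > 0\<close>\<close>
    define u :: "real ^ 'k" where "u = (\<chi> i. 1 / d i)"
    have Ju: "(J *v u) $ i = D" for i
      using d[of i] by (simp add: J_def matrix_vector_mult_def u_def diff_divide_distrib sum_subtractf
        if_distrib[of "\<lambda>x. x / _"] D_def s_def sum_distrib_left cong: if_cong)
    have "u \<noteq> 0" using d by (simp add: u_def vec_eq_iff less_imp_neq[THEN not_sym])
    then have "0 < u \<bullet> (J *v u)" by (rule pos)
    also have "\<dots> = s * D" unfolding inner_vec_def Ju by (simp add: u_def s_def sum_distrib_right)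
    finally show ?thesis using s by (simp add: zero_less_mult_iff)
  qed
  define \<gamma> where "\<gamma> = c / D"
  define B :: "real ^ 'k ^ 'k" where "B = (\<chi> i j. (if i = j then 1 / d i else 0) + \<gamma> / (d i * d j))"
  have delta: "(\<Sum>l\<in>UNIV. (if i = l then x else 0) * f l) = x * f i" for i :: 'k and x and f :: "'k \<Rightarrow> real"
    by (simp add: if_distrib[of "\<lambda>x. x * _"] cong: if_cong)
  have "J ** B = mat 1"
  proof -
    have "(J ** B) $ i $ j = mat 1 $ i $ j" for i j
    proof -
      have "(J ** B) $ i $ j = (\<Sum>l\<in>UNIV. (if i = l then d i else 0) * ((if l = j then 1 / d l else 0) + \<gamma> / (d l * d j)))
          - c * (\<Sum>l\<in>UNIV. (if l = j then 1 / d l else 0) + \<gamma> / (d l * d j))"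
        by (simp add: J_def B_def matrix_matrix_mult_def left_diff_distrib sum_subtractf sum_distrib_left)
      also have "(\<Sum>l\<in>UNIV. (if i = l then d i else 0) * ((if l = j then 1 / d l else 0) + \<gamma> / (d l * d j)))
          = (if i = j then 1 else 0) + \<gamma> / d j"
        unfolding delta using d[of i] d[of j] by (auto simp: distrib_left)
      also have "(\<Sum>l\<in>UNIV. (if l = j then 1 / d l else 0) + \<gamma> / (d l * d j)) = 1 / d j + \<gamma> * s / d j"
        by (simp add: sum.distrib s_def sum_distrib_left sum_divide_distrib)
      also have "(if i = j then 1 else 0) + \<gamma> / d j - c * (1 / d j + \<gamma> * s / d j)
          = (if i = j then 1 else 0) + (\<gamma> * D - c) / d j"
        by (simp add: D_def field_simps add_divide_distrib diff_divide_distrib)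
      also have "\<gamma> * D - c = 0" using D by (simp add: \<gamma>_def)
      finally show ?thesis by (simp add: mat_def)
    qed
    then show ?thesis by (simp add: vec_eq_iff)
  qed
  then have inv: "matrix_inv J = B" by (rule matrix_inv_unique)
  define w where "w i = 1 / sqrt (d i)" for i
  have w2: "w i * w i = 1 / d i" for i using d[of i] by (simp add: w_def)
  \<comment> \<open>the root of \<open>(1 + \<sigma> s)\<^sup>2 = 1 + \<gamma> s\<close>, where \<open>s\<close> is the squared norm of \<open>w\<close> and \<open>1 + \<gamma> s = 1 / D\<close>\<close>
  define \<sigma> where "\<sigma> = (1 / sqrt D - 1) / s"
  have \<sigma>: "2 * \<sigma> + \<sigma> * \<sigma> * s = \<gamma>"
  proof -
    have 1: "1 + \<sigma> * s = 1 / sqrt D" using s by (simp add: \<sigma>_def)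
    have "(2 * \<sigma> + \<sigma> * \<sigma> * s) * s = (1 + \<sigma> * s) * (1 + \<sigma> * s) - 1" by (simp add: algebra_simps)
    also have "\<dots> = 1 / D - 1" unfolding 1 using D by simp
    also have "\<dots> = \<gamma> * s" using D by (simp add: \<gamma>_def field_simps) (simp add: D_def)
    finally show ?thesis using s by simp
  qed
  define A :: "real ^ 'k ^ 'k" where "A = (\<chi> i j. (if i = j then w i else 0) + \<sigma> * (w i * w i) * w j)"
  have "A ** transpose A = B"
  proof -
    have "(A ** transpose A) $ i $ j = B $ i $ j" for i j
    proof -
      have "(A ** transpose A) $ i $ j = (\<Sum>l\<in>UNIV. (if i = l then w i else 0) * (if j = l then w j else 0)
          + (if i = l then w i else 0) * (\<sigma> * (w j * w j) * w l)
          + (if j = l then w j else 0) * (\<sigma> * (w i * w i) * w l)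
          + \<sigma> * \<sigma> * (w i * w i) * (w j * w j) * (w l * w l))"
        unfolding A_def matrix_matrix_mult_def transpose_def vec_lambda_beta
        by (intro sum.cong refl) (simp add: algebra_simps)
      also have "\<dots> = (if i = j then w i * w i else 0) + \<sigma> * (w j * w j) * (w i * w i)
          + \<sigma> * (w i * w i) * (w j * w j) + \<sigma> * \<sigma> * (w i * w i) * (w j * w j) * s"
        unfolding sum.distrib delta sum_distrib_left[symmetric] s_def w2[symmetric] by (simp add: mult_ac)
      also have "\<dots> = (if i = j then w i * w i else 0) + (2 * \<sigma> + \<sigma> * \<sigma> * s) * ((w i * w i) * (w j * w j))"
        by (simp add: algebra_simps)
      finally show ?thesis by (simp add: B_def w2 \<sigma>)
    qed
    then show ?thesis by (simp add: vec_eq_iff)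
  qed
  then show ?thesis using inv that by simp
qed


section \<open>The Dirichlet integral and the Dirichlet distribution\<close>

text \<open>
  The substitution \<open>t = s t'\<close> in the Beta integral. It integrates out one coordinate of the simplex
  when the others leave the length \<open>s\<close>.
\<close>

lemma nn_integral_Beta_scaled:
  fixes a b s :: real
  assumes "0 < a" "0 < b" "0 < s"
  shows "(\<integral>\<^sup>+t. ennreal (indicator {0<..<s} t * (t powr (a - 1) * (s - t) powr (b - 1))) \<partial>lborel)
      = ennreal (Beta a b * s powr (a + b - 1))"
proof -
  define f where "f s t = indicator {0<..<s} t * (t powr (a - 1) * (s - t) powr (b - 1))" for s t :: real
  have [measurable]: "f s \<in> borel_measurable borel" for s unfolding f_def by measurable
  have f_nonneg: "0 \<le> f s t" for s t unfolding f_def by auto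
  have "((\<lambda>t. t powr (a - 1) * (1 - t) powr (b - 1)) has_integral Beta a b) {0<..<1}"
    using has_integral_Beta_real[OF assms(1,2)] by (simp add: has_integral_Icc_iff_Ioo)
  then have "((\<lambda>t. if t \<in> {0<..<1} then t powr (a - 1) * (1 - t) powr (b - 1) else 0) has_integral Beta a b) UNIV"
    by (simp only: has_integral_restrict_UNIV)
  also have "(\<lambda>t. if t \<in> {0<..<1} then t powr (a - 1) * (1 - t) powr (b - 1) else 0) = f 1"
    by (auto simp: f_def)
  finally have unit: "(\<integral>\<^sup>+t. ennreal (f 1 t) \<partial>lborel) = ennreal (Beta a b)"
    by (intro nn_integral_has_integral_lborel f_nonneg) auto
  have scale: "f s (s * t) = s powr (a + b - 2) * f 1 t" for t
  proof (cases "0 < t \<and> t < 1")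
    case True
    have "s - s * t = s * (1 - t)" by (simp add: algebra_simps)
    moreover have "s powr (a + b - 2) = s powr (a - 1) * s powr (b - 1)"
      by (simp flip: powr_add)
    ultimately show ?thesis using True assms by (simp add: f_def powr_mult)
  next
    case False
    then have "\<not> (0 < s * t \<and> s * t < s)" using assms by (auto simp: zero_less_mult_iff)
    then show ?thesis using False by (auto simp: f_def)
  qed
  have "(\<integral>\<^sup>+t. ennreal (f s t) \<partial>lborel) = ennreal \<bar>s\<bar> * (\<integral>\<^sup>+t. ennreal (f s (0 + s * t)) \<partial>lborel)"
    using assms by (intro nn_integral_real_affine) auto
  also have "\<dots> = ennreal s * (ennreal (s powr (a + b - 2)) * ennreal (Beta a b))"
    using assms by (simp add: scale ennreal_mult' nn_integral_cmult unit)
  also have "\<dots> = ennreal (Beta a b * (s * s powr (a + b - 2)))"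
    using assms by (simp add: ennreal_mult'[symmetric] Beta_def mult_ac)
  also have "s * s powr (a + b - 2) = s powr (a + b - 1)"
    using assms powr_add[of s 1 "a + b - 2"] by simp
  finally show ?thesis unfolding f_def .
qed

text \<open>
  The unnormalized Dirichlet density in the free coordinates, with the exponent \<open>b\<close> of the dependent
  last coordinate kept separate: integrating out a free coordinate changes only \<open>b\<close>.
\<close>

definition dirichlet_kernel :: "'i set \<Rightarrow> ('i \<Rightarrow> real) \<Rightarrow> real \<Rightarrow> ('i \<Rightarrow> real) \<Rightarrow> real" where
  "dirichlet_kernel I a b y =
     (if (\<forall>i\<in>I. 0 < y i) \<and> (\<Sum>i\<in>I. y i) < 1
      then (\<Prod>i\<in>I. y i powr (a i - 1)) * (1 - (\<Sum>i\<in>I. y i)) powr (b - 1) else 0)"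

lemma dirichlet_kernel_measurable[measurable]:
  assumes [simp]: "finite I"
  shows "dirichlet_kernel I a b \<in> borel_measurable (\<Pi>\<^sub>M i\<in>I. lborel)"
  unfolding dirichlet_kernel_def by measurable

text \<open>
  Integrating out the coordinate \<open>i\<close> produces \<open>Beta (a i) b\<close> times the kernel in the remaining
  coordinates with \<open>b\<close> replaced by \<open>a i + b\<close>, and the Gamma factors telescope. This is why the
  induction has to leave \<open>b\<close> arbitrary.
\<close>

theorem dirichlet_integral:
  fixes a :: "'i \<Rightarrow> real"
  assumes "finite I" "\<And>i. i \<in> I \<Longrightarrow> 0 < a i" "0 < b"
  shows "(\<integral>\<^sup>+y. ennreal (dirichlet_kernel I a b y) \<partial>(\<Pi>\<^sub>M i\<in>I. lborel))
       = ennreal ((\<Prod>i\<in>I. Gamma (a i)) * Gamma b / Gamma ((\<Sum>i\<in>I. a i) + b))"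
  using assms
proof (induction I arbitrary: b rule: finite_induct)
  case empty
  interpret product_sigma_finite "\<lambda>_::'i. lborel :: real measure" by standard
  show ?case using empty Gamma_real_pos[of b]
    by (simp add: nn_integral_empty dirichlet_kernel_def space_PiM_empty less_imp_neq[THEN not_sym])
next
  case (insert i I)
  interpret product_sigma_finite "\<lambda>_::'i. lborel :: real measure" by standard
  have pos: "0 < a i" "0 < b" "\<And>j. j \<in> I \<Longrightarrow> 0 < a j" using insert.prems by auto
  have inner: "(\<integral>\<^sup>+t. ennreal (dirichlet_kernel (insert i I) a b (x(i := t))) \<partial>lborel)
      = ennreal (Beta (a i) b) * ennreal (dirichlet_kernel I a (a i + b) x)" for x
  proof -
    define s where "s = 1 - (\<Sum>j\<in>I. x j)"
    define P where "P = (\<Prod>j\<in>I. x j powr (a j - 1))"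
    have P: "0 \<le> P" unfolding P_def by (intro prod_nonneg) auto
    have "(x(i := t)) j = x j" if "j \<in> I" for t j using insert.hyps that by auto
    then have sum: "(\<Sum>j\<in>I. (x(i := t)) j) = (\<Sum>j\<in>I. x j)"
      and prod: "(\<Prod>j\<in>I. (x(i := t)) j powr (a j - 1)) = P"
      and all: "(\<forall>j\<in>I. 0 < (x(i := t)) j) \<longleftrightarrow> (\<forall>j\<in>I. 0 < x j)" for t
      unfolding P_def by (auto intro!: sum.cong prod.cong simp del: fun_upd_apply)
    have beta_nonneg: "0 \<le> Beta (a i) b" using pos by (simp add: Beta_def)
    have eq: "dirichlet_kernel (insert i I) a b (x(i := t))
      = (if \<forall>j\<in>I. 0 < x j then P * (indicator {0<..<s} t * (t powr (a i - 1) * (s - t) powr (b - 1))) else 0)" for t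
      unfolding dirichlet_kernel_def using insert.hyps
      by (simp add: sum prod all del: fun_upd_apply) (auto simp: s_def indicator_def algebra_simps)
    show ?thesis
    proof (cases "(\<forall>j\<in>I. 0 < x j) \<and> 0 < s")
      case True
      have "(\<integral>\<^sup>+t. ennreal (dirichlet_kernel (insert i I) a b (x(i := t))) \<partial>lborel)
          = ennreal P * ennreal (Beta (a i) b * s powr (a i + b - 1))"
        using True P pos by (simp add: eq ennreal_mult' nn_integral_cmult nn_integral_Beta_scaled[symmetric])
      also have "\<dots> = ennreal (Beta (a i) b) * ennreal (P * s powr (a i + b - 1))"
        using P beta_nonneg by (simp add: ennreal_mult' mult_ac)
      also have "P * s powr (a i + b - 1) = dirichlet_kernel I a (a i + b) x"
        using True by (simp add: dirichlet_kernel_def P_def s_def)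
      finally show ?thesis .
    next
      case False
      then have "dirichlet_kernel (insert i I) a b (x(i := t)) = 0" for t
        unfolding eq by (auto simp: indicator_def)
      moreover have "dirichlet_kernel I a (a i + b) x = 0"
        using False by (auto simp: dirichlet_kernel_def s_def)
      ultimately show ?thesis by simp
    qed
  qed
  have beta_nonneg: "0 \<le> Beta (a i) b" using pos by (simp add: Beta_def)
  have "(\<integral>\<^sup>+y. ennreal (dirichlet_kernel (insert i I) a b y) \<partial>(\<Pi>\<^sub>M i\<in>insert i I. lborel))
      = (\<integral>\<^sup>+x. ennreal (Beta (a i) b) * ennreal (dirichlet_kernel I a (a i + b) x) \<partial>(\<Pi>\<^sub>M i\<in>I. lborel))"
    using insert.hyps dirichlet_kernel_measurable[of "insert i I" a b]
    by (subst product_nn_integral_insert) (auto simp: inner simp del: fun_upd_apply)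
  also have "\<dots> = ennreal (Beta (a i) b) *
      ennreal ((\<Prod>i\<in>I. Gamma (a i)) * Gamma (a i + b) / Gamma ((\<Sum>i\<in>I. a i) + (a i + b)))"
    using insert.hyps dirichlet_kernel_measurable[of I a "a i + b"] pos
    by (subst nn_integral_cmult) (auto simp: insert.IH)
  also have "\<dots> = ennreal (Beta (a i) b * ((\<Prod>i\<in>I. Gamma (a i)) * Gamma (a i + b) / Gamma ((\<Sum>i\<in>I. a i) + (a i + b))))"
    using beta_nonneg by (simp only: ennreal_mult')
  also have "Beta (a i) b * ((\<Prod>i\<in>I. Gamma (a i)) * Gamma (a i + b) / Gamma ((\<Sum>i\<in>I. a i) + (a i + b)))
     = (\<Prod>i\<in>insert i I. Gamma (a i)) * Gamma b / Gamma ((\<Sum>i\<in>insert i I. a i) + b)"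
    using insert.hyps pos Gamma_real_pos[of "a i + b", THEN less_imp_neq]
    by (auto simp: Beta_def add_ac mult_ac)
  finally show ?case .
qed

abbreviation free_coords :: "('k::{finite,linorder}) set" where
  "free_coords \<equiv> UNIV - {Max UNIV}"

lemma sum_UNIV_split:
  fixes f :: "'k::{finite,linorder} \<Rightarrow> real"
  shows "(\<Sum>i\<in>UNIV. f i) = (\<Sum>i\<in>free_coords. f i) + f (Max UNIV)"
  by (subst sum.remove[of UNIV "Max UNIV"]) auto

lemma prod_UNIV_split:
  fixes f :: "'k::{finite,linorder} \<Rightarrow> real"
  shows "(\<Prod>i\<in>UNIV. f i) = (\<Prod>i\<in>free_coords. f i) * f (Max UNIV)"
  by (subst prod.remove[of UNIV "Max UNIV"]) auto

text \<open>
  With at least two coordinates the upper bounds by \<open>1\<close> follow from positivity and the sum. With a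
  single coordinate the open simplex is empty.
\<close>

lemma simplex_point_in_open_simplex:
  fixes y :: "'k::{finite,linorder} \<Rightarrow> real"
  assumes "2 \<le> CARD('k)"
  shows "simplex_point y \<in> open_simplex \<longleftrightarrow> (\<forall>i\<in>free_coords. 0 < y i) \<and> (\<Sum>i\<in>free_coords. y i) < 1"
    (is "?L \<longleftrightarrow> ?R")
proof
  assume L: ?L
  have "0 < simplex_point y $ i" for i using L by (simp add: open_simplex_def)
  from this[of "Max UNIV"] this show ?R
    by (auto simp: simplex_point_def split: if_splits) (metis)
next
  assume R: ?R
  have "card (free_coords :: 'k set) \<noteq> 0" using assms by (simp add: card_Diff_singleton)
  then have ne: "(free_coords :: 'k set) \<noteq> {}" by force
  have "0 < (\<Sum>i\<in>free_coords. y i)" using R ne by (intro sum_pos) auto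
  moreover have "y i < 1" if "i \<in> free_coords" for i
    using R member_le_sum[of i free_coords y] that by (simp add: less_imp_le)
  moreover have "(\<Sum>i\<in>free_coords. simplex_point y $ i) = (\<Sum>i\<in>free_coords. y i)"
    by (intro sum.cong) (auto simp: simplex_point_def)
  ultimately show ?L using R
    by (auto simp: open_simplex_def sum_UNIV_split) (auto simp: simplex_point_def)
qed

lemma simplex_point_measurable[measurable]:
  "(simplex_point :: ('k::{finite,linorder} \<Rightarrow> real) \<Rightarrow> _) \<in> borel_measurable (\<Pi>\<^sub>M i\<in>free_coords. lborel)"
proof (rule measurable_vec_lambda)
  fix i :: 'k
  show "(\<lambda>y. simplex_point y $ i) \<in> borel_measurable (\<Pi>\<^sub>M i\<in>free_coords. lborel)"
    by (cases "i = Max UNIV") (auto simp: simplex_point_def)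
qed

lemma open_simplex_measurable[measurable]: "open_simplex \<in> sets (borel :: (real ^ 'k) measure)"
  unfolding open_simplex_def by measurable

lemma dirichlet_density_measurable[measurable]: "dirichlet_density \<alpha> \<in> borel_measurable borel"
  unfolding dirichlet_density_def[abs_def] by measurable

lemma log_vec_measurable[measurable]: "log_vec \<in> borel_measurable borel"
  by (rule measurable_vec_lambda) (simp add: log_vec_def)

lemma sets_dirichlet[measurable_cong, simp]: "sets (dirichlet \<alpha>) = sets borel"
  by (simp add: dirichlet_def)

lemma nn_integral_dirichlet:
  assumes [measurable]: "g \<in> borel_measurable borel"
  shows "(\<integral>\<^sup>+x. g x \<partial>dirichlet \<alpha>) =
    (\<integral>\<^sup>+y. ennreal (dirichlet_density \<alpha> (simplex_point y)) * g (simplex_point y) \<partial>(\<Pi>\<^sub>M i\<in>free_coords. lborel))"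
  unfolding dirichlet_def by (subst nn_integral_distr) (simp_all add: nn_integral_density)

text \<open>
  The log-partition function of the exponential family.
\<close>

definition dirichlet_log_norm :: "real ^ 'k \<Rightarrow> real" where
  "dirichlet_log_norm a = (\<Sum>i\<in>UNIV. ln_Gamma (a $ i)) - ln_Gamma (\<Sum>i\<in>UNIV. a $ i)"

lemma sum_pos_of_positive_vecs: "a \<in> positive_vecs \<Longrightarrow> 0 < (\<Sum>i\<in>UNIV. a $ i)"
  by (intro sum_pos) (auto simp: positive_vecs_def)

lemma dirichlet_density_exp:
  assumes a: "a \<in> positive_vecs" and x: "x \<in> open_simplex"
  shows "dirichlet_density a x = exp ((a - 1) \<bullet> log_vec x - dirichlet_log_norm a)"
proof -
  have xpos: "0 < x $ i" for i using x by (simp add: open_simplex_def)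
  have apos: "0 < a $ i" for i using a by (simp add: positive_vecs_def)
  have G: "Gamma (a $ i) = exp (ln_Gamma (a $ i))" for i
    using Gamma_real_pos_exp[OF apos] .
  have G0: "Gamma (\<Sum>i\<in>UNIV. a $ i) = exp (ln_Gamma (\<Sum>i\<in>UNIV. a $ i))"
    using Gamma_real_pos_exp[OF sum_pos_of_positive_vecs[OF a]] .
  have "(\<Prod>i\<in>UNIV. x $ i powr (a $ i - 1)) = exp ((a - 1) \<bullet> log_vec x)"
    using xpos by (simp add: powr_def exp_sum inner_vec_def log_vec_def less_imp_neq[THEN not_sym])
  then show ?thesis
    using x by (simp add: dirichlet_density_def dirichlet_log_norm_def G G0 exp_diff exp_sum)
qed

lemma nn_integral_dirichlet_density:
  fixes \<alpha> :: "(real, 'k::{finite,linorder}) vec"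
  assumes "2 \<le> CARD('k)" "\<alpha> \<in> positive_vecs"
  shows "(\<integral>\<^sup>+y. ennreal (dirichlet_density \<alpha> (simplex_point y)) \<partial>(\<Pi>\<^sub>M i\<in>free_coords. lborel)) = 1"
proof -
  have apos: "0 < \<alpha> $ i" for i using assms by (simp add: positive_vecs_def)
  define c where "c = Gamma (\<Sum>i\<in>UNIV. \<alpha> $ i) / (\<Prod>i\<in>UNIV. Gamma (\<alpha> $ i))"
  have g0: "0 < Gamma (\<Sum>i\<in>UNIV. \<alpha> $ i)" "0 < (\<Prod>i\<in>UNIV. Gamma (\<alpha> $ i))"
    using sum_pos_of_positive_vecs[OF assms(2)] apos by (auto intro!: prod_pos)
  then have c: "0 \<le> c" by (simp add: c_def del: prod_zero_iff)
  have "(\<Prod>i\<in>free_coords. simplex_point y $ i powr (\<alpha> $ i - 1)) = (\<Prod>i\<in>free_coords. y i powr (\<alpha> $ i - 1))" for y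
    by (intro prod.cong) (auto simp: simplex_point_def)
  then have "dirichlet_density \<alpha> (simplex_point y)
      = c * dirichlet_kernel free_coords (\<lambda>i. \<alpha> $ i) (\<alpha> $ Max UNIV) y" for y
    unfolding dirichlet_density_def simplex_point_in_open_simplex[OF assms(1)] dirichlet_kernel_def c_def[symmetric]
    by (subst (1) prod_UNIV_split) (simp add: simplex_point_def)
  then have "(\<integral>\<^sup>+y. ennreal (dirichlet_density \<alpha> (simplex_point y)) \<partial>(\<Pi>\<^sub>M i\<in>free_coords. lborel))
      = ennreal c * ennreal ((\<Prod>i\<in>free_coords. Gamma (\<alpha> $ i)) * Gamma (\<alpha> $ Max UNIV)
          / Gamma ((\<Sum>i\<in>free_coords. \<alpha> $ i) + \<alpha> $ Max UNIV))"
    using c apos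
    by (simp add: ennreal_mult' nn_integral_cmult dirichlet_integral)
  also have "\<dots> = ennreal (c * ((\<Prod>i\<in>UNIV. Gamma (\<alpha> $ i)) / Gamma (\<Sum>i\<in>UNIV. \<alpha> $ i)))"
    unfolding sum_UNIV_split prod_UNIV_split using c by (simp only: ennreal_mult')
  also have "c * ((\<Prod>i\<in>UNIV. Gamma (\<alpha> $ i)) / Gamma (\<Sum>i\<in>UNIV. \<alpha> $ i)) = 1"
    using g0 unfolding c_def by (simp del: prod_zero_iff)
  finally show ?thesis by simp
qed

lemma prob_space_dirichlet:
  fixes \<alpha> :: "(real, 'k::{finite,linorder}) vec"
  assumes "2 \<le> CARD('k)" "\<alpha> \<in> positive_vecs"
  shows "prob_space (dirichlet \<alpha>)"
proof
  have "emeasure (dirichlet \<alpha>) (space (dirichlet \<alpha>)) = (\<integral>\<^sup>+x. 1 \<partial>dirichlet \<alpha>)"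
    by simp
  also have "\<dots> = 1"
    by (subst nn_integral_dirichlet) (use nn_integral_dirichlet_density[OF assms] in auto)
  finally show "emeasure (dirichlet \<alpha>) (space (dirichlet \<alpha>)) = 1" .
qed

text \<open>
  The null sets do not depend on the parameter, because every density is positive on the whole open
  simplex.
\<close>

lemma AE_dirichlet:
  fixes \<alpha> :: "(real, 'k::{finite,linorder}) vec"
  assumes \<alpha>: "\<alpha> \<in> positive_vecs" and [measurable]: "Measurable.pred borel P"
  shows "(AE x in dirichlet \<alpha>. P x) \<longleftrightarrow>
    (AE y in (\<Pi>\<^sub>M i\<in>free_coords. lborel). simplex_point y \<in> open_simplex \<longrightarrow> P (simplex_point y))"
proof -
  have "0 < dirichlet_density \<alpha> x \<longleftrightarrow> x \<in> open_simplex" for x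
    using dirichlet_density_exp[OF \<alpha>] by (cases "x \<in> open_simplex") (auto simp: dirichlet_density_def)
  then show ?thesis
    unfolding dirichlet_def by (subst AE_distr_iff) (auto simp: AE_density)
qed

lemma AE_dirichlet_open_simplex: "\<alpha> \<in> positive_vecs \<Longrightarrow> AE x in dirichlet \<alpha>. x \<in> open_simplex"
  by (subst AE_dirichlet) auto

text \<open>
  Tilting the density by \<open>exp (u \<bullet> log x)\<close> shifts the parameter by \<open>u\<close>, so the integral is the quotient
  of the two normalizing constants.
\<close>

lemma dirichlet_mgf:
  fixes \<alpha> :: "(real, 'k::{finite,linorder}) vec"
  assumes k: "2 \<le> CARD('k)" and \<alpha>: "\<alpha> \<in> positive_vecs" and u: "\<alpha> + u \<in> positive_vecs"
  shows "has_bochner_integral (dirichlet \<alpha>) (\<lambda>x. exp (u \<bullet> log_vec x))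
    (exp (dirichlet_log_norm (\<alpha> + u) - dirichlet_log_norm \<alpha>))"
proof (rule has_bochner_integral_nn_integral)
  let ?c = "exp (dirichlet_log_norm (\<alpha> + u) - dirichlet_log_norm \<alpha>)"
  have eq: "dirichlet_density \<alpha> x * exp (u \<bullet> log_vec x) = ?c * dirichlet_density (\<alpha> + u) x" for x
  proof (cases "x \<in> open_simplex")
    case True
    then show ?thesis
      by (simp add: dirichlet_density_exp \<alpha> u exp_add[symmetric] inner_add_left inner_diff_left algebra_simps)
  qed (simp add: dirichlet_density_def)
  have nonneg: "0 \<le> dirichlet_density (\<alpha> + u) x" for x
    using dirichlet_density_exp[OF u] by (cases "x \<in> open_simplex") (auto simp: dirichlet_density_def)
  have "(\<integral>\<^sup>+x. ennreal (exp (u \<bullet> log_vec x)) \<partial>dirichlet \<alpha>)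
      = (\<integral>\<^sup>+y. ennreal (?c * dirichlet_density (\<alpha> + u) (simplex_point y)) \<partial>(\<Pi>\<^sub>M i\<in>free_coords. lborel))"
    by (subst nn_integral_dirichlet) (auto simp: ennreal_mult''[symmetric] eq)
  also have "\<dots> = ennreal ?c"
    using nonneg by (simp add: ennreal_mult' nn_integral_cmult nn_integral_dirichlet_density[OF k u])
  finally show "(\<integral>\<^sup>+x. ennreal (exp (u \<bullet> log_vec x)) \<partial>dirichlet \<alpha>) = ennreal ?c" .
qed auto

section \<open>Mean and covariance of the logarithm of a Dirichlet vector\<close>

text \<open>
  The gradient of \<open>dirichlet_log_norm\<close>.
\<close>

definition dirichlet_mean_log :: "real ^ 'k \<Rightarrow> real ^ 'k" where
  "dirichlet_mean_log a = (\<chi> i. Digamma (a $ i) - Digamma (\<Sum>j\<in>UNIV. a $ j))"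

text \<open>
  The Hessian of \<open>dirichlet_log_norm\<close>, which is the Fisher information matrix.
\<close>

definition dirichlet_information :: "real ^ 'k \<Rightarrow> real ^ 'k ^ 'k" where
  "dirichlet_information a =
     (\<chi> i j. (if i = j then Polygamma 1 (a $ i) else 0) - Polygamma 1 (\<Sum>l\<in>UNIV. a $ l))"

lemma open_positive_vecs: "open (positive_vecs :: (real ^ 'k) set)"
proof -
  have "positive_vecs = (\<Inter>i. {a :: real ^ 'k. 0 < a $ i})" by (auto simp: positive_vecs_def)
  moreover have "open {a :: real ^ 'k. 0 < a $ i}" for i
    by (intro open_Collect_less continuous_intros)
  then have "open (\<Inter>i. {a :: real ^ 'k. 0 < a $ i})" by (intro open_INT) auto
  ultimately show ?thesis by (rule ssubst)
qed

lemma segment_in_positive_vecs: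
  assumes "a \<in> positive_vecs" "b \<in> positive_vecs" "0 \<le> t" "t \<le> (1::real)"
  shows "a + t *\<^sub>R (b - a) \<in> positive_vecs"
  unfolding positive_vecs_def
proof (intro CollectI allI)
  fix i
  have "0 < (1 - t) * a $ i + t * b $ i"
  proof (cases "t = 0")
    case False
    then have "0 < t * b $ i" "0 \<le> (1 - t) * a $ i"
      using assms by (auto simp: positive_vecs_def less_imp_le)
    then show ?thesis by simp
  qed (use assms in \<open>simp add: positive_vecs_def\<close>)
  then show "0 < (a + t *\<^sub>R (b - a)) $ i" by (simp add: algebra_simps)
qed

lemma line_in_positive_vecs:
  assumes "a \<in> positive_vecs"
  obtains \<epsilon> where "0 < \<epsilon>" "\<And>t. \<bar>t\<bar> < \<epsilon> \<Longrightarrow> a + t *\<^sub>R u \<in> positive_vecs"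
proof -
  have "open ((\<lambda>t. a + t *\<^sub>R u) -` positive_vecs)"
    by (intro continuous_open_vimage open_positive_vecs) (auto intro!: continuous_intros)
  moreover have "0 \<in> (\<lambda>t. a + t *\<^sub>R u) -` positive_vecs" using assms by simp
  ultimately obtain \<epsilon> where "0 < \<epsilon>" "ball 0 \<epsilon> \<subseteq> (\<lambda>t. a + t *\<^sub>R u) -` positive_vecs"
    using openE by blast
  then show ?thesis by (intro that[of \<epsilon>]) (auto simp: subset_iff)
qed

lemma dirichlet_log_norm_line_derivative:
  assumes "a + t *\<^sub>R u \<in> positive_vecs"
  shows "((\<lambda>t. dirichlet_log_norm (a + t *\<^sub>R u)) has_real_derivative u \<bullet> dirichlet_mean_log (a + t *\<^sub>R u)) (at t)"
proof -
  have pos: "0 < a $ i + t * u $ i" for i using assms by (auto simp: positive_vecs_def)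
  have pos': "0 < (\<Sum>i\<in>UNIV. a $ i + t * u $ i)" by (intro sum_pos pos) auto
  show ?thesis
    unfolding dirichlet_log_norm_def dirichlet_mean_log_def inner_vec_def
    by (auto intro!: derivative_eq_intros DERIV_chain2[OF has_field_derivative_ln_Gamma_real] pos pos'
      simp: sum_subtractf sum_distrib_left sum_distrib_right algebra_simps)
qed

lemma pos_not_nonpos_Ints: "0 < (x::real) \<Longrightarrow> x \<notin> \<int>\<^sub>\<le>\<^sub>0"
  by (auto elim!: nonpos_Ints_cases)

lemma dirichlet_information_mult:
  "(dirichlet_information b *v u) $ i
     = Polygamma 1 (b $ i) * u $ i - Polygamma 1 (\<Sum>l\<in>UNIV. b $ l) * (\<Sum>j\<in>UNIV. u $ j)"
  by (simp add: dirichlet_information_def matrix_vector_mult_def left_diff_distrib sum_subtractf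
    sum_distrib_left if_distrib[of "\<lambda>x. x * _"] cong: if_cong)

lemma dirichlet_mean_log_line_derivative:
  assumes "a + t *\<^sub>R u \<in> positive_vecs"
  shows "((\<lambda>t. v \<bullet> dirichlet_mean_log (a + t *\<^sub>R u)) has_real_derivative
     v \<bullet> (dirichlet_information (a + t *\<^sub>R u) *v u)) (at t)"
proof -
  have pos: "0 < a $ i + t * u $ i" for i using assms by (auto simp: positive_vecs_def)
  have pos': "0 < (\<Sum>i\<in>UNIV. a $ i + t * u $ i)" by (intro sum_pos pos) auto
  show ?thesis
    unfolding inner_vec_def dirichlet_information_mult unfolding dirichlet_mean_log_def
    by (auto intro!: derivative_eq_intros pos_not_nonpos_Ints pos pos'
      simp: sum_distrib_left sum_distrib_right algebra_simps)
qed

text \<open>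
  The moment generating function along the line through \<open>a\<close> in direction \<open>u\<close> is the exponential of
  the increment of \<open>dirichlet_log_norm\<close>. Differentiating it twice gives the first two moments.
\<close>

lemma
  fixes a :: "(real, 'k::{finite,linorder}) vec"
  assumes k: "2 \<le> CARD('k)" and a: "a \<in> positive_vecs"
  shows dirichlet_log_square_integrable: "integrable (dirichlet a) (\<lambda>x. (u \<bullet> log_vec x)\<^sup>2)"
    and dirichlet_expectation_log: "(\<integral>x. u \<bullet> log_vec x \<partial>dirichlet a) = u \<bullet> dirichlet_mean_log a"
    and dirichlet_second_moment_log: "(\<integral>x. (u \<bullet> log_vec x)\<^sup>2 \<partial>dirichlet a)
      = (u \<bullet> dirichlet_mean_log a)\<^sup>2 + u \<bullet> (dirichlet_information a *v u)"
proof -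
  obtain \<epsilon> where \<epsilon>: "0 < \<epsilon>" "\<And>t. \<bar>t\<bar> < \<epsilon> \<Longrightarrow> a + t *\<^sub>R u \<in> positive_vecs"
    using line_in_positive_vecs[OF a, of u] by blast
  define F where "F t = exp (dirichlet_log_norm (a + t *\<^sub>R u) - dirichlet_log_norm a)" for t
  define F' where "F' t = F t * (u \<bullet> dirichlet_mean_log (a + t *\<^sub>R u))" for t
  have mgf: "has_bochner_integral (dirichlet a) (\<lambda>x. exp (t * (u \<bullet> log_vec x))) (F t)" if "\<bar>t\<bar> < \<epsilon>" for t
    using dirichlet_mgf[OF k a \<epsilon>(2)[OF that]] by (simp add: F_def)
  have F': "(F has_real_derivative F' t) (at t)" if "\<bar>t\<bar> < \<epsilon>" for t
    unfolding F_def F'_def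
    by (auto intro!: derivative_eq_intros dirichlet_log_norm_line_derivative \<epsilon>(2) that)
  have F'': "(F' has_real_derivative
      (u \<bullet> dirichlet_mean_log a)\<^sup>2 + u \<bullet> (dirichlet_information a *v u)) (at 0)"
    using DERIV_mult[OF F'[of 0] dirichlet_mean_log_line_derivative[of a 0 u u]] a \<epsilon>(1)
    unfolding F'_def[abs_def] by (simp add: F_def power2_eq_square)
  note * = moments_from_mgf[OF prob_space_dirichlet[OF k a], of "\<lambda>x. u \<bullet> log_vec x" \<epsilon> F F',
      OF _ \<epsilon>(1) _ _ F' F'']
  show "integrable (dirichlet a) (\<lambda>x. (u \<bullet> log_vec x)\<^sup>2)"
    "(\<integral>x. u \<bullet> log_vec x \<partial>dirichlet a) = u \<bullet> dirichlet_mean_log a"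
    "(\<integral>x. (u \<bullet> log_vec x)\<^sup>2 \<partial>dirichlet a)
      = (u \<bullet> dirichlet_mean_log a)\<^sup>2 + u \<bullet> (dirichlet_information a *v u)"
    by (rule *(1) *(2)[THEN trans] *(3);
      use mgf in \<open>auto simp: has_bochner_integral_iff F'_def F_def\<close>)+
qed

lemma dirichlet_log_integrable:
  fixes a :: "(real, 'k::{finite,linorder}) vec"
  assumes "2 \<le> CARD('k)" "a \<in> positive_vecs"
  shows "integrable (dirichlet a) (\<lambda>x. u \<bullet> log_vec x)"
proof -
  interpret prob_space "dirichlet a" by (rule prob_space_dirichlet[OF assms])
  show ?thesis
    by (rule square_integrable_imp_integrable[OF _ dirichlet_log_square_integrable[OF assms]]) simp
qed

lemma
  fixes a :: "(real, 'k::{finite,linorder}) vec"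
  assumes k: "2 \<le> CARD('k)" and a: "a \<in> positive_vecs"
  shows integrable_log_vec_dirichlet: "integrable (dirichlet a) log_vec"
    and moment_map_dirichlet: "moment_map dirichlet log_vec a = dirichlet_mean_log a"
proof -
  show int: "integrable (dirichlet a) log_vec"
    using dirichlet_log_integrable[OF assms, of "axis _ 1"]
    by (intro integrable_vec) (simp add: inner_axis')
  show "moment_map dirichlet log_vec a = dirichlet_mean_log a"
    unfolding moment_map_def vec_eq_iff
  proof
    fix i
    have "(\<integral>x. log_vec x \<partial>dirichlet a) $ i = (\<integral>x. log_vec x $ i \<partial>dirichlet a)"
      by (rule integral_bounded_linear[OF bounded_linear_vec_nth int, symmetric])
    then show "(\<integral>x. log_vec x \<partial>dirichlet a) $ i = dirichlet_mean_log a $ i"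
      using dirichlet_expectation_log[OF assms, of "axis i 1"] by (simp add: inner_axis')
  qed
qed

lemma
  fixes a :: "(real, 'k::{finite,linorder}) vec"
  assumes k: "2 \<le> CARD('k)" and a: "a \<in> positive_vecs"
  shows dirichlet_centered_log_square_integrable:
      "integrable (dirichlet a) (\<lambda>x. (u \<bullet> (log_vec x - dirichlet_mean_log a))\<^sup>2)"
    and dirichlet_variance_log: "(\<integral>x. (u \<bullet> (log_vec x - dirichlet_mean_log a))\<^sup>2 \<partial>dirichlet a)
      = u \<bullet> (dirichlet_information a *v u)"
proof -
  interpret prob_space "dirichlet a" by (rule prob_space_dirichlet[OF assms])
  let ?m = "u \<bullet> dirichlet_mean_log a"
  have eq: "(u \<bullet> (log_vec x - dirichlet_mean_log a))\<^sup>2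
      = (u \<bullet> log_vec x)\<^sup>2 - 2 * ?m * (u \<bullet> log_vec x) + ?m\<^sup>2" for x
    by (simp add: inner_diff_right power2_diff)
  note int = dirichlet_log_square_integrable[OF assms, of u] dirichlet_log_integrable[OF assms, of u]
  show "integrable (dirichlet a) (\<lambda>x. (u \<bullet> (log_vec x - dirichlet_mean_log a))\<^sup>2)"
    unfolding eq using int by simp
  have "(\<integral>x. (u \<bullet> (log_vec x - dirichlet_mean_log a))\<^sup>2 \<partial>dirichlet a)
      = (\<integral>x. (u \<bullet> log_vec x)\<^sup>2 \<partial>dirichlet a) - 2 * ?m * (\<integral>x. u \<bullet> log_vec x \<partial>dirichlet a) + ?m\<^sup>2"
    unfolding eq using int by (simp add: prob_space)
  then show "(\<integral>x. (u \<bullet> (log_vec x - dirichlet_mean_log a))\<^sup>2 \<partial>dirichlet a)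
      = u \<bullet> (dirichlet_information a *v u)"
    unfolding dirichlet_second_moment_log[OF assms] dirichlet_expectation_log[OF assms]
    by (simp add: power2_eq_square)
qed

lemma dirichlet_information_sym: "transpose (dirichlet_information a) = dirichlet_information a"
  by (simp add: dirichlet_information_def transpose_def vec_eq_iff)

text \<open>
  The variances of all projections determine the covariance matrix by polarization, both matrices
  being symmetric.
\<close>

lemma covariance_matrix_log_dirichlet:
  fixes a :: "(real, 'k::{finite,linorder}) vec"
  assumes k: "2 \<le> CARD('k)" and a: "a \<in> positive_vecs"
  shows "covariance_matrix (dirichlet a) log_vec = dirichlet_information a"
  unfolding vec_eq_iff
proof (intro allI)
  fix i j
  let ?J = "dirichlet_information a" and ?m = "dirichlet_mean_log a"
  define Q where "Q u = (\<integral>x. (u \<bullet> (log_vec x - ?m))\<^sup>2 \<partial>dirichlet a)" for u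
  let ?u = "axis i 1 :: (real, 'k) vec" and ?v = "axis j 1 :: (real, 'k) vec"
  have mean: "(\<integral>x. log_vec x $ l \<partial>dirichlet a) = ?m $ l" for l
    using dirichlet_expectation_log[OF assms, of "axis l 1"] by (simp add: inner_axis')
  have "covariance_matrix (dirichlet a) log_vec $ i $ j
      = (\<integral>x. (log_vec x $ i - ?m $ i) * (log_vec x $ j - ?m $ j) \<partial>dirichlet a)"
    by (simp add: covariance_matrix_def mean)
  also have "\<dots> = (\<integral>x. (((?u + ?v) \<bullet> (log_vec x - ?m))\<^sup>2 - (?u \<bullet> (log_vec x - ?m))\<^sup>2
        - (?v \<bullet> (log_vec x - ?m))\<^sup>2) / 2 \<partial>dirichlet a)"
    by (intro Bochner_Integration.integral_cong refl)
      (simp add: inner_add_left inner_axis' power2_eq_square algebra_simps)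
  also have "\<dots> = (Q (?u + ?v) - Q ?u - Q ?v) / 2"
    using dirichlet_centered_log_square_integrable[OF assms] by (simp add: Q_def)
  also have "\<dots> = (?u \<bullet> (?J *v ?v) + ?v \<bullet> (?J *v ?u)) / 2"
    unfolding Q_def dirichlet_variance_log[OF assms]
    by (simp add: inner_add_left inner_add_right matrix_vector_right_distrib)
  also have "\<dots> = (?J $ i $ j + ?J $ j $ i) / 2"
    by (simp add: inner_axis' matrix_vector_mult_basis column_def)
  also have "?J $ j $ i = ?J $ i $ j"
    by (simp add: dirichlet_information_def)
  finally show "covariance_matrix (dirichlet a) log_vec $ i $ j = ?J $ i $ j" by simp
qed

text \<open>
  An almost sure linear relation for one parameter holds for every parameter \<open>b\<close>, hence
  \<open>u \<bullet> dirichlet_mean_log b = c\<close> for all \<open>b\<close>. Raising \<open>b i\<close> by one changes the left side by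
  \<open>u i / b i\<close> minus the sum of \<open>u\<close> over the sum of \<open>b\<close>, because \<open>\<psi>(z + 1) = \<psi>(z) + 1 / z\<close>. Comparing
  this at two parameters leaves only \<open>u = 0\<close>.
\<close>

lemma log_dirichlet_not_in_hyperplane:
  fixes a :: "(real, 'k::{finite,linorder}) vec"
  assumes k: "2 \<le> CARD('k)" and a: "a \<in> positive_vecs"
    and const: "AE x in dirichlet a. u \<bullet> log_vec x = c"
  shows "u = 0"
proof -
  have mean: "u \<bullet> dirichlet_mean_log b = c" if b: "b \<in> positive_vecs" for b
  proof -
    interpret prob_space "dirichlet b" by (rule prob_space_dirichlet[OF k b])
    have "AE x in dirichlet b. u \<bullet> log_vec x = c"
      using const by (simp add: AE_dirichlet a b)
    then have "(\<integral>x. u \<bullet> log_vec x \<partial>dirichlet b) = (\<integral>x. c \<partial>dirichlet b)"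
      by (intro integral_cong_AE) auto
    then show ?thesis
      by (simp add: dirichlet_expectation_log[OF k b] prob_space)
  qed
  have step: "u $ i / b $ i = (\<Sum>j\<in>UNIV. u $ j) / (\<Sum>j\<in>UNIV. b $ j)" if b: "b \<in> positive_vecs" for b i
  proof -
    have b': "b + axis i 1 \<in> positive_vecs"
      using b by (auto simp: positive_vecs_def axis_def add_pos_nonneg)
    have bi: "0 < b $ i" and b0: "0 < (\<Sum>j\<in>UNIV. b $ j)"
      using b sum_pos_of_positive_vecs by (auto simp: positive_vecs_def)
    have s: "(\<Sum>j\<in>UNIV. (b + axis i 1) $ j) = (\<Sum>j\<in>UNIV. b $ j) + 1"
      by (simp add: sum.distrib axis_def)
    have "dirichlet_mean_log (b + axis i 1) - dirichlet_mean_log b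
        = (1 / b $ i) *\<^sub>R axis i 1 - (1 / (\<Sum>j\<in>UNIV. b $ j)) *\<^sub>R 1"
      unfolding vec_eq_iff dirichlet_mean_log_def s
      using bi b0 by (simp add: axis_def Digamma_plus1)
    moreover have "u \<bullet> (dirichlet_mean_log (b + axis i 1) - dirichlet_mean_log b) = 0"
      by (simp add: inner_diff_right mean b b')
    ultimately show ?thesis
      by (simp add: inner_diff_right inner_axis) (simp add: inner_vec_def sum_divide_distrib)
  qed
  define U where "U = (\<Sum>j\<in>UNIV. u $ j)"
  have ones: "(1 :: (real, 'k) vec) \<in> positive_vecs" by (simp add: positive_vecs_def)
  have u: "u $ i = U / real CARD('k)" for i
    using step[OF ones, of i] by (simp add: U_def)
  \<comment> \<open>at \<open>b = 1\<close> the relation gives \<open>u i = U / k\<close>, at \<open>b = 1\<close> with the entry \<open>i\<close> raised to \<open>2\<close> it gives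
    \<open>u i / 2 = U / (k + 1)\<close>, and these agree only for \<open>U = 0\<close> as \<open>k \<noteq> 1\<close>\<close>
  have "U = 0"
  proof -
    fix i :: 'k
    have "1 + axis i 1 \<in> (positive_vecs :: (real, 'k) vec set)"
      by (auto simp: positive_vecs_def axis_def)
    moreover have "(\<Sum>j\<in>UNIV. (1 + axis i 1 :: (real, 'k) vec) $ j) = real CARD('k) + 1"
      "(1 + axis i 1 :: (real, 'k) vec) $ i = 2"
      by (simp_all add: sum.distrib axis_def)
    ultimately have "u $ i / 2 = U / (real CARD('k) + 1)"
      using step[of "1 + axis i 1" i] by (simp only: U_def)
    then have "U * (real CARD('k) - 1) = 0" using u[of i] k by (simp add: field_simps)
    then show "U = 0" using k by simp
  qed
  then show ?thesis by (simp add: vec_eq_iff u)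
qed

text \<open>
  The quadratic form is the variance of \<open>u \<bullet> log X\<close>. If it vanished, \<open>u \<bullet> log X\<close> would be almost surely
  constant.
\<close>

lemma dirichlet_information_pos_def:
  fixes a :: "(real, 'k::{finite,linorder}) vec"
  assumes k: "2 \<le> CARD('k)" and a: "a \<in> positive_vecs" and "u \<noteq> 0"
  shows "0 < u \<bullet> (dirichlet_information a *v u)"
proof -
  let ?f = "\<lambda>x. (u \<bullet> (log_vec x - dirichlet_mean_log a))\<^sup>2"
  note var = dirichlet_variance_log[OF k a, of u]
  have "0 \<le> u \<bullet> (dirichlet_information a *v u)" unfolding var[symmetric] by simp
  moreover have "u \<bullet> (dirichlet_information a *v u) \<noteq> 0"
  proof
    assume "u \<bullet> (dirichlet_information a *v u) = 0"
    then have "AE x in dirichlet a. ?f x = 0"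
      using var integral_nonneg_eq_0_iff_AE[OF dirichlet_centered_log_square_integrable[OF k a, of u]] by simp
    then have "AE x in dirichlet a. u \<bullet> log_vec x = u \<bullet> dirichlet_mean_log a"
      by (simp add: inner_diff_right)
    then show False using log_dirichlet_not_in_hyperplane[OF k a] \<open>u \<noteq> 0\<close> by blast
  qed
  ultimately show ?thesis by simp
qed

text \<open>
  Along the segment from \<open>a\<close> to \<open>b\<close> the second derivative is positive, so the mean slope exceeds the
  initial slope.
\<close>

lemma dirichlet_log_norm_strict_convex:
  fixes a b :: "(real, 'k::{finite,linorder}) vec"
  assumes k: "2 \<le> CARD('k)" and a: "a \<in> positive_vecs" and b: "b \<in> positive_vecs" and "a \<noteq> b"
  shows "(b - a) \<bullet> dirichlet_mean_log a < dirichlet_log_norm b - dirichlet_log_norm a"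
proof -
  let ?u = "b - a"
  have in': "a + t *\<^sub>R ?u \<in> positive_vecs" if "0 \<le> t" "t \<le> 1" for t
    by (rule segment_in_positive_vecs[OF a b that])
  have "\<exists>z>0. z < 1 \<and> dirichlet_log_norm (a + 1 *\<^sub>R ?u) - dirichlet_log_norm (a + 0 *\<^sub>R ?u)
      = (1 - 0) * (?u \<bullet> dirichlet_mean_log (a + z *\<^sub>R ?u))"
    by (rule MVT2) (auto intro!: dirichlet_log_norm_line_derivative in')
  then obtain z where z: "0 < z" "z < 1"
    "dirichlet_log_norm b - dirichlet_log_norm a = ?u \<bullet> dirichlet_mean_log (a + z *\<^sub>R ?u)" by auto
  have "?u \<bullet> dirichlet_mean_log (a + 0 *\<^sub>R ?u) < ?u \<bullet> dirichlet_mean_log (a + z *\<^sub>R ?u)"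
  proof (rule DERIV_pos_imp_increasing[OF z(1)])
    fix t assume "0 \<le> t" "t \<le> z"
    then show "\<exists>y. ((\<lambda>t. ?u \<bullet> dirichlet_mean_log (a + t *\<^sub>R ?u)) has_real_derivative y) (at t) \<and> 0 < y"
      using in'[of t] z dirichlet_mean_log_line_derivative[of a t ?u ?u]
        dirichlet_information_pos_def[OF k, of "a + t *\<^sub>R ?u" ?u] \<open>a \<noteq> b\<close> by auto
  qed
  then show ?thesis using z by simp
qed

lemma inj_on_dirichlet_mean_log:
  assumes "2 \<le> CARD('k::{finite,linorder})"
  shows "inj_on dirichlet_mean_log (positive_vecs :: (real, 'k) vec set)"
proof (rule inj_onI, rule ccontr)
  fix a b :: "(real, 'k) vec"
  assume ab: "a \<in> positive_vecs" "b \<in> positive_vecs" "dirichlet_mean_log a = dirichlet_mean_log b" "a \<noteq> b"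
  then show False
    using dirichlet_log_norm_strict_convex[OF assms, of a b] dirichlet_log_norm_strict_convex[OF assms, of b a]
    by (simp add: inner_diff_left)
qed

section \<open>The maximum likelihood estimator as a moment-type estimator\<close>

lemma dirichlet_likelihood_exp:
  assumes b: "b \<in> positive_vecs" and N: "1 \<le> N" and x: "\<forall>n\<in>{1..N}. x n \<in> open_simplex"
  shows "(\<Prod>n = 1..N. dirichlet_density b (x n))
    = exp (real N * ((b - 1) \<bullet> sample_mean log_vec N x - dirichlet_log_norm b))"
proof -
  have "(\<Prod>n = 1..N. dirichlet_density b (x n))
      = (\<Prod>n = 1..N. exp ((b - 1) \<bullet> log_vec (x n) - dirichlet_log_norm b))"
    using x by (intro prod.cong refl dirichlet_density_exp b) auto
  also have "\<dots> = exp ((b - 1) \<bullet> (\<Sum>n = 1..N. log_vec (x n)) - real N * dirichlet_log_norm b)"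
    by (simp add: exp_sum[symmetric] sum_subtractf inner_sum_right)
  also have "(\<Sum>n = 1..N. log_vec (x n)) = real N *\<^sub>R sample_mean log_vec N x"
    using N by (simp add: sample_mean_def)
  finally show ?thesis by (simp add: algebra_simps)
qed

text \<open>
  A maximizer is an interior point, so all directional derivatives vanish there. Conversely, strict
  convexity makes a critical point of the log-likelihood its only maximizer.
\<close>

lemma is_maximum_likelihood_dirichlet_iff:
  fixes x :: "nat \<Rightarrow> (real, 'k::{finite,linorder}) vec"
  assumes k: "2 \<le> CARD('k)" and N: "1 \<le> N" and x: "\<forall>n\<in>{1..N}. x n \<in> open_simplex"
  shows "is_maximum_likelihood dirichlet_density positive_vecs N x a \<longleftrightarrow>
    a \<in> positive_vecs \<and> dirichlet_mean_log a = sample_mean log_vec N x"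
proof -
  let ?L = "sample_mean log_vec N x"
  have likelihood_le: "(\<Prod>n = 1..N. dirichlet_density b (x n)) \<le> (\<Prod>n = 1..N. dirichlet_density a (x n))
      \<longleftrightarrow> b \<bullet> ?L - dirichlet_log_norm b \<le> a \<bullet> ?L - dirichlet_log_norm a"
    if "a \<in> positive_vecs" "b \<in> positive_vecs" for b
    unfolding dirichlet_likelihood_exp[OF that(1) N x] dirichlet_likelihood_exp[OF that(2) N x]
    using N by (simp add: inner_diff_left)
  have ml: "is_maximum_likelihood dirichlet_density positive_vecs N x a \<longleftrightarrow> a \<in> positive_vecs \<and>
      (\<forall>b\<in>positive_vecs. b \<bullet> ?L - dirichlet_log_norm b \<le> a \<bullet> ?L - dirichlet_log_norm a)"
    unfolding is_maximum_likelihood_def using likelihood_le by blast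
  show ?thesis
  proof
    assume "is_maximum_likelihood dirichlet_density positive_vecs N x a"
    then have a: "a \<in> positive_vecs"
      and max: "\<And>b. b \<in> positive_vecs \<Longrightarrow> b \<bullet> ?L - dirichlet_log_norm b \<le> a \<bullet> ?L - dirichlet_log_norm a"
      using ml by auto
    have "u \<bullet> (?L - dirichlet_mean_log a) = 0" for u
    proof -
      obtain \<epsilon> where \<epsilon>: "0 < \<epsilon>" "\<And>t. \<bar>t\<bar> < \<epsilon> \<Longrightarrow> a + t *\<^sub>R u \<in> positive_vecs"
        using line_in_positive_vecs[OF a, of u] by blast
      let ?h = "\<lambda>t. (a + t *\<^sub>R u) \<bullet> ?L - dirichlet_log_norm (a + t *\<^sub>R u)"
      have "(?h has_real_derivative u \<bullet> ?L - u \<bullet> dirichlet_mean_log (a + 0 *\<^sub>R u)) (at 0)"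
        using a by (auto intro!: derivative_eq_intros dirichlet_log_norm_line_derivative simp: inner_add_left)
      moreover have "\<forall>t. \<bar>0 - t\<bar> < \<epsilon> \<longrightarrow> ?h t \<le> ?h 0"
        using max \<epsilon>(2) by simp
      ultimately have "u \<bullet> ?L - u \<bullet> dirichlet_mean_log (a + 0 *\<^sub>R u) = 0"
        using \<epsilon>(1) DERIV_local_max by blast
      then show ?thesis by (simp add: inner_diff_right)
    qed
    then show "a \<in> positive_vecs \<and> dirichlet_mean_log a = ?L"
      using a by (metis inner_eq_zero_iff eq_iff_diff_eq_0)
  next
    assume a: "a \<in> positive_vecs \<and> dirichlet_mean_log a = ?L"
    have "b \<bullet> ?L - dirichlet_log_norm b \<le> a \<bullet> ?L - dirichlet_log_norm a" if "b \<in> positive_vecs" for b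
      using a that dirichlet_log_norm_strict_convex[OF k, of a b]
      by (cases "a = b") (auto simp: inner_diff_left)
    then show "is_maximum_likelihood dirichlet_density positive_vecs N x a"
      using a ml by blast
  qed
qed

lemma dirichlet_likelihood_system_iff:
  "dirichlet_likelihood_system N x a \<longleftrightarrow> dirichlet_mean_log a = sample_mean log_vec N x"
  by (auto simp: dirichlet_likelihood_system_def dirichlet_mean_log_def sample_mean_def vec_eq_iff log_vec_def)

text \<open>
  Outside the image of \<open>dirichlet_mean_log\<close> the value is \<open>0\<close>, which is not a positive vector, so that
  membership of the value in \<open>positive_vecs\<close> decides whether the estimator exists. The constant value
  also keeps the function Borel measurable on the whole space.
\<close>

definition dirichlet_mean_log_inv :: "real ^ 'k \<Rightarrow> real ^ 'k" where
  "dirichlet_mean_log_inv y =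
     (if y \<in> dirichlet_mean_log ` positive_vecs then inv_into positive_vecs dirichlet_mean_log y else 0)"

lemma dirichlet_mean_log_inv_in_positive_vecs:
  "dirichlet_mean_log_inv y \<in> positive_vecs \<longleftrightarrow> y \<in> dirichlet_mean_log ` positive_vecs"
  by (auto simp: dirichlet_mean_log_inv_def inv_into_into) (auto simp: positive_vecs_def)

lemma dirichlet_mean_log_inv:
  assumes "2 \<le> CARD('k::{finite,linorder})" "a \<in> (positive_vecs :: (real, 'k) vec set)"
  shows "dirichlet_mean_log_inv (dirichlet_mean_log a) = a"
  using assms inj_on_dirichlet_mean_log[OF assms(1)] by (simp add: dirichlet_mean_log_inv_def)

lemma dirichlet_mle_eq:
  fixes x :: "nat \<Rightarrow> (real, 'k::{finite,linorder}) vec"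
  assumes k: "2 \<le> CARD('k)" and N: "1 \<le> N" and x: "\<forall>n\<in>{1..N}. x n \<in> open_simplex"
  shows "dirichlet_mle N x =
    (if sample_mean log_vec N x \<in> dirichlet_mean_log ` positive_vecs
     then Some (dirichlet_mean_log_inv (sample_mean log_vec N x)) else None)"
proof (cases "sample_mean log_vec N x \<in> dirichlet_mean_log ` positive_vecs")
  case True
  then obtain a where a: "a \<in> positive_vecs" "sample_mean log_vec N x = dirichlet_mean_log a" by blast
  have "is_maximum_likelihood dirichlet_density positive_vecs N x b \<longleftrightarrow> b = a" for b
    using a inj_onD[OF inj_on_dirichlet_mean_log[OF k]]
    by (auto simp: is_maximum_likelihood_dirichlet_iff[OF k N x])
  then show ?thesis using a by (auto simp: mle_def dirichlet_mean_log_inv[OF k])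
next
  case False
  then have "\<not> is_maximum_likelihood dirichlet_density positive_vecs N x b" for b
    unfolding is_maximum_likelihood_dirichlet_iff[OF k N x] by (metis image_eqI)
  then show ?thesis using False by (auto simp: mle_def)
qed

text \<open>
  All likelihoods vanish, so every parameter is a maximizer and none is unique. This settles
  existence of the estimator on the null event of observations off the open simplex, where measurability
  could otherwise fail.
\<close>

lemma dirichlet_mle_outside_simplex:
  assumes "n \<in> {1..N}" "x n \<notin> open_simplex"
  shows "dirichlet_mle N x = None"
proof -
  have zero: "(\<Prod>n = 1..N. dirichlet_density b (x n)) = 0" for b
    using assms by (auto simp: dirichlet_density_def)
  have "is_maximum_likelihood dirichlet_density positive_vecs N x 1"
    "is_maximum_likelihood dirichlet_density positive_vecs N x (1 + 1)"
    by (auto simp: is_maximum_likelihood_def zero positive_vecs_def simp del: One_nat_def)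
  moreover have "(1 :: (real, 'a) vec) \<noteq> 1 + 1" by (simp add: vec_eq_iff)
  ultimately have "\<nexists>!b. is_maximum_likelihood dirichlet_density positive_vecs N x b" by metis
  then show ?thesis by (simp add: mle_def)
qed

lemma moment_type_estimator_dirichlet_mle:
  assumes k: "2 \<le> CARD('k::{finite,linorder})"
  shows "moment_type_estimator (dirichlet :: (real, 'k) vec \<Rightarrow> _) positive_vecs open_simplex log_vec dirichlet_mle"
  unfolding moment_type_estimator_def
proof (intro conjI exI[of _ dirichlet_mean_log_inv] ballI allI impI)
  show "inj_on (moment_map (dirichlet :: (real, 'k) vec \<Rightarrow> _) log_vec) positive_vecs"
    using inj_on_dirichlet_mean_log[OF k] by (rule inj_on_cong[THEN iffD1, rotated]) (simp add: moment_map_dirichlet[OF k])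
next
  fix N and x :: "nat \<Rightarrow> (real, 'k) vec" assume "1 \<le> N" "\<forall>n\<in>{1..N}. x n \<in> open_simplex"
  then show "dirichlet_mle N x = (if dirichlet_mean_log_inv (sample_mean log_vec N x) \<in> positive_vecs
      then Some (dirichlet_mean_log_inv (sample_mean log_vec N x)) else None)"
    unfolding dirichlet_mean_log_inv_in_positive_vecs by (intro dirichlet_mle_eq k) auto
qed (simp_all add: k integrable_log_vec_dirichlet moment_map_dirichlet dirichlet_mean_log_inv)

lemma dirichlet_mean_log_derivative:
  assumes "a \<in> positive_vecs"
  shows "(dirichlet_mean_log has_derivative (*v) (dirichlet_information a)) (at a)"
proof (subst has_derivative_componentwise_within, intro ballI)
  fix b :: "real ^ 'a" assume "b \<in> Basis"
  then obtain i where b: "b = axis i 1" by (auto simp: Basis_vec_def)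
  have pos: "0 < a $ j" for j using assms by (simp add: positive_vecs_def)
  have "((\<lambda>x. Digamma (x $ i) - Digamma (\<Sum>j\<in>UNIV. x $ j)) has_derivative
     (\<lambda>h. h $ i * Polygamma 1 (a $ i) - (\<Sum>j\<in>UNIV. h $ j) * Polygamma 1 (\<Sum>j\<in>UNIV. a $ j))) (at a)"
  proof (rule has_derivative_diff)
    show "((\<lambda>x. Digamma (x $ i)) has_derivative (\<lambda>h. h $ i * Polygamma 1 (a $ i))) (at a)"
      using has_derivative_compose[of "\<lambda>x. x $ i" "\<lambda>h. h $ i" a UNIV Digamma "\<lambda>h. h * Polygamma 1 (a $ i)"]
        has_field_derivative_Polygamma[OF pos_not_nonpos_Ints[OF pos[of i]], of 0]
      by (simp add: has_field_derivative_def mult.commute bounded_linear_imp_has_derivative bounded_linear_vec_nth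
          mult_commute_abs)
    show "((\<lambda>x. Digamma (\<Sum>j\<in>UNIV. x $ j)) has_derivative
       (\<lambda>h. (\<Sum>j\<in>UNIV. h $ j) * Polygamma 1 (\<Sum>j\<in>UNIV. a $ j))) (at a)"
      using has_derivative_compose[of "\<lambda>x. \<Sum>j\<in>UNIV. x $ j" "\<lambda>h. \<Sum>j\<in>UNIV. h $ j" a UNIV Digamma
          "\<lambda>h. h * Polygamma 1 (\<Sum>j\<in>UNIV. a $ j)"]
        has_field_derivative_Polygamma[OF pos_not_nonpos_Ints[OF sum_pos_of_positive_vecs[OF assms]], of 0]
      by (simp add: has_field_derivative_def mult.commute bounded_linear_imp_has_derivative bounded_linear_vec_nth
          bounded_linear_sum mult_commute_abs)
  qed
  moreover have "(dirichlet_information a *v h) $ i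
      = h $ i * Polygamma 1 (a $ i) - (\<Sum>j\<in>UNIV. h $ j) * Polygamma 1 (\<Sum>j\<in>UNIV. a $ j)" for h
    unfolding dirichlet_information_mult by simp
  ultimately show "((\<lambda>x. dirichlet_mean_log x \<bullet> b) has_derivative (\<lambda>x. (dirichlet_information a *v x) \<bullet> b)) (at a)"
    by (simp add: b inner_axis dirichlet_mean_log_def)
qed

lemma continuous_on_dirichlet_mean_log: "continuous_on positive_vecs dirichlet_mean_log"
  using dirichlet_mean_log_derivative has_derivative_continuous
  by (blast intro: continuous_at_imp_continuous_on)

lemma
  assumes k: "2 \<le> CARD('k::{finite,linorder})"
  shows open_dirichlet_mean_log_image: "open (dirichlet_mean_log ` (positive_vecs :: (real, 'k) vec set))"
    and continuous_on_dirichlet_mean_log_inv: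
      "continuous_on (dirichlet_mean_log ` (positive_vecs :: (real, 'k) vec set)) dirichlet_mean_log_inv"
  by (intro invariance_of_domain continuous_on_inverse_open open_positive_vecs
      continuous_on_dirichlet_mean_log inj_on_dirichlet_mean_log k; simp add: dirichlet_mean_log_inv k)+

lemma invertible_dirichlet_information:
  fixes a :: "(real, 'k::{finite,linorder}) vec"
  assumes "2 \<le> CARD('k)" "a \<in> positive_vecs"
  shows "invertible (dirichlet_information a)"
proof -
  have "\<forall>u. dirichlet_information a *v u = 0 \<longrightarrow> u = 0"
    using dirichlet_information_pos_def[OF assms] by (metis inner_zero_right less_irrefl)
  then show ?thesis
    using matrix_left_invertible_ker[of "dirichlet_information a"]
    by (metis invertible_left_inverse)
qed

text \<open>
  The inverse exists on a neighbourhood of the image point as a continuous function, and its derivative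
  inverts that of \<open>dirichlet_mean_log\<close>.
\<close>

lemma dirichlet_mean_log_inv_derivative:
  fixes a :: "(real, 'k::{finite,linorder}) vec"
  assumes k: "2 \<le> CARD('k)" and a: "a \<in> positive_vecs"
  shows "(dirichlet_mean_log_inv has_derivative (*v) (matrix_inv (dirichlet_information a)))
     (at (dirichlet_mean_log a))"
proof (rule has_derivative_inverse_strong[OF open_positive_vecs a continuous_on_dirichlet_mean_log])
  show "(*v) (dirichlet_information a) \<circ> (*v) (matrix_inv (dirichlet_information a)) = id"
    using matrix_inv_right[OF invertible_dirichlet_information[OF assms]]
    by (simp add: fun_eq_iff matrix_vector_mul_assoc)
qed (auto intro: dirichlet_mean_log_inv k dirichlet_mean_log_derivative a)

section \<open>The limit law of the maximum likelihood estimator\<close>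

lemma dirichlet_information_inverse_factor:
  fixes a :: "(real, 'k::{finite,linorder}) vec"
  assumes k: "2 \<le> CARD('k)" and a: "a \<in> positive_vecs"
  obtains A :: "((real, 'k) vec, 'k) vec" where "A ** transpose A = matrix_inv (dirichlet_information a)"
proof -
  have "0 < Polygamma 1 (a $ i)" for i
    using a by (intro Polygamma_real_odd_pos pos_not_nonpos_Ints) (auto simp: positive_vecs_def)
  from factor_of_inverse_information[of "\<lambda>i. Polygamma 1 (a $ i)" "Polygamma 1 (\<Sum>l\<in>UNIV. a $ l)",
      folded dirichlet_information_def, OF this dirichlet_information_pos_def[OF k a]]
  show ?thesis using that by blast
qed

lemma dirichlet_mean_log_inv_measurable:
  assumes k: "2 \<le> CARD('k::{finite,linorder})"
  shows "(dirichlet_mean_log_inv :: (real, 'k) vec \<Rightarrow> _) \<in> borel_measurable borel"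
proof -
  let ?U = "dirichlet_mean_log ` (positive_vecs :: (real, 'k) vec set)"
  have "(\<lambda>y. indicator ?U y *\<^sub>R dirichlet_mean_log_inv y) \<in> borel_measurable borel"
    by (rule borel_measurable_continuous_on_indicator)
      (use open_dirichlet_mean_log_image[OF k] continuous_on_dirichlet_mean_log_inv[OF k] in auto)
  also have "(\<lambda>y. indicator ?U y *\<^sub>R dirichlet_mean_log_inv y) = (dirichlet_mean_log_inv :: (real, 'k) vec \<Rightarrow> _)"
    by (auto simp: indicator_def dirichlet_mean_log_inv_def)
  finally show ?thesis .
qed

text \<open>
  The estimator is \<open>dirichlet_mean_log_inv\<close> at the sample mean whenever the sample lies in the simplex
  and the mean in the image of \<open>dirichlet_mean_log\<close>; the first event is almost sure, the second has
  probability tending to \<open>1\<close> because the image is open. The central limit theorem for the sample mean and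
  the delta method then yield the limit law.
\<close>

lemma has_asymptotic_covariance_dirichlet_mle:
  fixes M :: "'a measure"
    and X :: "nat \<Rightarrow> 'a \<Rightarrow> (real, 'k :: {finite, linorder}) vec"
  assumes k: "2 \<le> CARD('k)" and \<alpha>: "\<alpha> \<in> positive_vecs" and M: "prob_space M"
    and indep: "prob_space.indep_vars M (\<lambda>_. borel) X {1..}"
    and distr: "\<And>n. 1 \<le> n \<Longrightarrow> distr M borel (X n) = dirichlet \<alpha>"
  shows "has_asymptotic_covariance M \<alpha> (\<lambda>N \<omega>. dirichlet_mle N (\<lambda>n. X n \<omega>))
      (matrix_inv (dirichlet_information \<alpha>))"
proof -
  interpret prob_space M by fact
  let ?T = "\<lambda>N \<omega>. dirichlet_mle N (\<lambda>n. X n \<omega>)"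
  let ?m = "dirichlet_mean_log \<alpha>" and ?J = "dirichlet_information \<alpha>"
  let ?U = "dirichlet_mean_log ` (positive_vecs :: (real, 'k) vec set)"
  let ?mean = "\<lambda>N \<omega>. sample_mean log_vec N (\<lambda>n. X n \<omega>)"
  define S where "S N \<omega> = sqrt (real N) *\<^sub>R (?mean N \<omega> - ?m)" for N \<omega>
  have U: "open ?U" "?m \<in> ?U" using open_dirichlet_mean_log_image[OF k] \<alpha> by auto
  have [measurable]: "?U \<in> sets borel" using U(1) by simp
  note [measurable] = dirichlet_mean_log_inv_measurable[OF k]
  have X_meas[measurable]: "X n \<in> borel_measurable M" if "n \<in> {1..N}" for n N
    using indep that by (auto simp: indep_vars_def)
  have mean_meas[measurable]: "?mean N \<in> borel_measurable M" for N
    unfolding sample_mean_def by measurable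
  have S_meas[measurable]: "S N \<in> borel_measurable M" for N unfolding S_def by measurable
  have mean_S: "?m + S N \<omega> /\<^sub>R sqrt (real N) = ?mean N \<omega>" if "1 \<le> N" for N \<omega>
    using that by (simp add: S_def)

  define good where "good N \<omega> \<longleftrightarrow> (\<forall>n\<in>{1..N}. X n \<omega> \<in> open_simplex)" for N \<omega>
  have good_meas[measurable]: "Measurable.pred M (good N)" for N
    unfolding good_def by measurable
  have good_AE: "AE \<omega> in M. good N \<omega>" for N
    unfolding good_def
  proof (rule AE_finite_allI)
    fix n assume n: "n \<in> {1..N}"
    have "AE x in distr M borel (X n). x \<in> open_simplex"
      using AE_dirichlet_open_simplex[OF \<alpha>] n by (subst distr) auto
    then show "AE \<omega> in M. X n \<omega> \<in> open_simplex" by (subst (asm) AE_distr_iff) (use n in auto)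
  qed simp
  have T: "?T N \<omega> = (if good N \<omega> \<and> ?mean N \<omega> \<in> ?U then Some (dirichlet_mean_log_inv (?mean N \<omega>)) else None)"
    if "1 \<le> N" for N \<omega>
  proof (cases "good N \<omega>")
    case True
    then show ?thesis by (simp add: good_def dirichlet_mle_eq[OF k that])
  next
    case False
    then show ?thesis unfolding good_def using dirichlet_mle_outside_simplex[of _ N "\<lambda>n. X n \<omega>"] by auto
  qed
  have err: "rescaled_error \<alpha> ?T N \<omega> = (if good N \<omega> \<and> ?mean N \<omega> \<in> ?U
      then sqrt (real N) *\<^sub>R (dirichlet_mean_log_inv (?mean N \<omega>) - \<alpha>) else 0)" if "1 \<le> N" for N \<omega>
    unfolding rescaled_error_def T[OF that] by simp
  have err_meas: "rescaled_error \<alpha> ?T N \<in> borel_measurable M" if "1 \<le> N" for N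
    unfolding err[OF that, abs_def] by measurable
  have exists_set: "{\<omega> \<in> space M. ?T N \<omega> \<noteq> None} = {\<omega> \<in> space M. good N \<omega> \<and> ?mean N \<omega> \<in> ?U}"
    if "1 \<le> N" for N
    unfolding T[OF that] by auto

  let ?\<nu> = "distr (dirichlet \<alpha>) borel log_vec"
  have clt: "(\<lambda>N. \<integral>\<omega>. cis (u \<bullet> S N \<omega>) \<partial>M) \<longlonglongrightarrow> complex_of_real (exp (- (u \<bullet> (?J *v u)) / 2))" for u
  proof -
    have "(\<lambda>N. \<integral>\<omega>. cis (u \<bullet> (sqrt (real N) *\<^sub>R (sample_mean id N (\<lambda>n. log_vec (X n \<omega>)) - ?m))) \<partial>M)
        \<longlonglongrightarrow> complex_of_real (exp (- (u \<bullet> (?J *v u)) / 2))"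
    proof (rule central_limit_characteristic_function[OF M, where \<nu> = ?\<nu>])
      show "indep_vars (\<lambda>_. borel) (\<lambda>n \<omega>. log_vec (X n \<omega>)) {1..}"
        by (rule indep_vars_compose2[OF indep]) simp
      show "distr M borel (\<lambda>\<omega>. log_vec (X n \<omega>)) = ?\<nu>" if "1 \<le> n" for n
        unfolding distr[OF that, symmetric] using X_meas[of n n] that by (subst distr_distr) (auto simp: comp_def)
      show "integrable ?\<nu> (\<lambda>y. (v \<bullet> (y - ?m))\<^sup>2)" for v
        by (subst integrable_distr_eq) (auto intro: dirichlet_centered_log_square_integrable[OF k \<alpha>])
      show "(\<integral>y. v \<bullet> (y - ?m) \<partial>?\<nu>) = 0" for v
      proof -
        interpret D: prob_space "dirichlet \<alpha>" by (rule prob_space_dirichlet[OF k \<alpha>])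
        show ?thesis
          by (subst integral_distr) (auto simp: inner_diff_right dirichlet_log_integrable[OF k \<alpha>]
            dirichlet_expectation_log[OF k \<alpha>] D.prob_space)
      qed
      show "(\<integral>y. (v \<bullet> (y - ?m))\<^sup>2 \<partial>?\<nu>) = v \<bullet> (?J *v v)" for v
        by (subst integral_distr) (auto intro: dirichlet_variance_log[OF k \<alpha>])
    qed (rule dirichlet_information_pos_def[OF k \<alpha>])
    then show ?thesis by (simp add: S_def sample_mean_def)
  qed
  obtain A :: "((real, 'k) vec, 'k) vec" where A: "A ** transpose A = matrix_inv ?J"
    by (rule dirichlet_information_inverse_factor[OF k \<alpha>])
  have J_inv: "?J ** matrix_inv ?J = mat 1"
    by (rule matrix_inv_right[OF invertible_dirichlet_information[OF k \<alpha>]])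
  have inv_sym: "transpose (matrix_inv ?J) = matrix_inv ?J"
    unfolding A[symmetric] by (simp add: matrix_transpose_mul)
  have clt': "(\<lambda>N. \<integral>\<omega>. cis (u \<bullet> (matrix_inv ?J *v S N \<omega>)) \<partial>M)
      \<longlonglongrightarrow> complex_of_real (exp (- (u \<bullet> (matrix_inv ?J *v u)) / 2))" for u
  proof -
    \<comment> \<open>by symmetry of \<open>J\<^sup>-\<^sup>1\<close> the frequency \<open>u\<close> for \<open>J\<^sup>-\<^sup>1 S\<close> is the frequency \<open>J\<^sup>-\<^sup>1 u\<close> for \<open>S\<close>\<close>
    let ?v = "matrix_inv ?J *v u"
    have "u \<bullet> (matrix_inv ?J *v S N \<omega>) = ?v \<bullet> S N \<omega>" for N \<omega>
      by (metis dot_lmul_matrix inv_sym vector_transpose_matrix)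
    moreover have "?v \<bullet> (?J *v ?v) = u \<bullet> (matrix_inv ?J *v u)"
      by (simp add: matrix_vector_mul_assoc J_inv inner_commute)
    ultimately show ?thesis using clt[of ?v] by simp
  qed

  define Z where "Z = (distr std_normal_vec borel ((*v) A))"
  have Z: "prob_space Z" "sets Z = sets borel"
    "\<And>u. (\<integral>z. cis (u \<bullet> z) \<partial>Z) = complex_of_real (exp (- (u \<bullet> (matrix_inv ?J *v u)) / 2))"
    unfolding Z_def characteristic_function_normal A by (rule prob_space_normal refl sets_distr)+
  \<comment> \<open>the limit law of \<open>S\<close>: from \<open>A A\<^sup>T = J\<^sup>-\<^sup>1\<close> the matrix \<open>J A\<close> is a factor of \<open>J\<close>, and convergence to a
    probability law makes \<open>S\<close> tight\<close>
  define W where "W = distr std_normal_vec borel ((*v) (?J ** A))"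
  have "(?J ** A) ** transpose (?J ** A) = ?J ** (A ** transpose A) ** ?J"
    by (simp add: matrix_transpose_mul dirichlet_information_sym matrix_mul_assoc)
  then have W_cov: "(?J ** A) ** transpose (?J ** A) = ?J"
    by (simp add: A J_inv)
  have W: "prob_space W" "sets W = sets borel"
    "\<And>u. (\<integral>z. cis (u \<bullet> z) \<partial>W) = complex_of_real (exp (- (u \<bullet> (?J *v u)) / 2))"
    unfolding W_def characteristic_function_normal W_cov by (rule prob_space_normal refl sets_distr)+
  have tight: "\<exists>R. \<forall>\<^sub>F N in sequentially. prob {\<omega> \<in> space M. R < norm (S N \<omega>)} < \<epsilon>" if "0 < \<epsilon>" for \<epsilon>
  proof -
    have conv: "(\<lambda>N. \<integral>x. cis (u \<bullet> x) \<partial>distr M borel (S N)) \<longlonglongrightarrow> (\<integral>x. cis (u \<bullet> x) \<partial>W)" for u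
      unfolding W(3) using clt[of u] by (subst integral_distr) (auto simp: cis_conv_exp)
    obtain R where "\<forall>\<^sub>F N in sequentially. measure (distr M borel (S N)) {x. R < norm x} < \<epsilon>"
      by (rule characteristic_function_imp_tight[where \<mu> = "\<lambda>N. distr M borel (S N)",
        OF prob_space_distr[OF S_meas] sets_distr W(1,2) conv \<open>0 < \<epsilon>\<close>])
    moreover have "measure (distr M borel (S N)) {x. R < norm x} = prob {\<omega> \<in> space M. R < norm (S N \<omega>)}" for N
      by (subst measure_distr) (auto intro!: arg_cong[where f = prob])
    ultimately show ?thesis by auto
  qed
  show ?thesis
    unfolding has_asymptotic_covariance_def
  proof (intro conjI allI impI exI[of _ Z])
    show "{\<omega> \<in> space M. ?T N \<omega> \<noteq> None} \<in> events" if "1 \<le> N" for N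
      unfolding exists_set[OF that] by measurable
    show "rescaled_error \<alpha> ?T N \<in> borel_measurable M" if "1 \<le> N" for N
      by (rule err_meas[OF that])
    show "(\<lambda>N. prob {\<omega> \<in> space M. ?T N \<omega> \<noteq> None}) \<longlonglongrightarrow> 1"
    proof (rule Lim_transform_eventually)
      show "(\<lambda>N. prob {\<omega> \<in> space M. ?m + S N \<omega> /\<^sub>R sqrt (real N) \<in> ?U}) \<longlonglongrightarrow> 1"
        by (rule tight_rescaled_prob_tendsto_1[OF M S_meas tight U])
      show "\<forall>\<^sub>F N in sequentially. prob {\<omega> \<in> space M. ?m + S N \<omega> /\<^sub>R sqrt (real N) \<in> ?U}
          = prob {\<omega> \<in> space M. ?T N \<omega> \<noteq> None}"
      proof (rule eventually_sequentiallyI[of 1])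
        fix N :: nat assume "1 \<le> N"
        show "prob {\<omega> \<in> space M. ?m + S N \<omega> /\<^sub>R sqrt (real N) \<in> ?U} = prob {\<omega> \<in> space M. ?T N \<omega> \<noteq> None}"
          unfolding exists_set[OF \<open>1 \<le> N\<close>] mean_S[OF \<open>1 \<le> N\<close>]
          using good_AE[of N] by (intro measure_eq_AE) auto
      qed
    qed
    show "centered_normal (matrix_inv ?J) Z"
      unfolding centered_normal_def Z_def using A by blast
    have char_err: "(\<lambda>N. \<integral>\<omega>. cis (u \<bullet> rescaled_error \<alpha> ?T N \<omega>) \<partial>M) \<longlonglongrightarrow> (\<integral>z. cis (u \<bullet> z) \<partial>Z)" for u
      unfolding Z(3)
    proof (rule delta_method_characteristic_function[OF M S_meas err_meas tight U _ 
          dirichlet_mean_log_inv_derivative[OF k \<alpha>] clt'])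
      fix N :: nat assume N: "1 \<le> N"
      show "AE \<omega> in M. ?m + S N \<omega> /\<^sub>R sqrt (real N) \<in> ?U \<longrightarrow> rescaled_error \<alpha> ?T N \<omega>
          = sqrt (real N) *\<^sub>R (dirichlet_mean_log_inv (?m + S N \<omega> /\<^sub>R sqrt (real N)) - dirichlet_mean_log_inv ?m)"
        using good_AE[of N]
        by eventually_elim (simp add: mean_S[OF N] err[OF N] dirichlet_mean_log_inv[OF k \<alpha>])
    qed
    \<comment> \<open>the shift starts the sequence at sample size \<open>1\<close>, from where on the laws are probability measures\<close>
    have "converges_in_law (\<lambda>N. distr M borel (rescaled_error \<alpha> ?T (Suc N))) Z"
    proof (rule converges_in_law_characteristic_function)
      show "(\<lambda>N. \<integral>x. cis (u \<bullet> x) \<partial>distr M borel (rescaled_error \<alpha> ?T (Suc N))) \<longlonglongrightarrow> (\<integral>z. cis (u \<bullet> z) \<partial>Z)" for u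
        using LIMSEQ_Suc[OF char_err[of u]] err_meas
        by (subst integral_distr) (auto simp: cis_conv_exp)
    qed (auto intro!: prob_space_distr err_meas Z)
    then show "converges_in_law (\<lambda>N. distr M borel (rescaled_error \<alpha> ?T N)) Z"
      unfolding converges_in_law_def by (auto intro: LIMSEQ_imp_Suc)
  qed
qed

theorem proposition3p4:
  fixes M :: "'a measure"
    and X :: "nat \<Rightarrow> 'a \<Rightarrow> (real, 'k :: {finite, linorder}) vec"
    and \<alpha> :: "(real, 'k) vec"
  assumes "CARD('k) \<ge> 2"
    and "\<alpha> \<in> positive_vecs"
    and "prob_space M"
    and "prob_space.indep_vars M (\<lambda>_. borel) X {1..}"
    and "\<And>n. n \<ge> 1 \<Longrightarrow> distr M borel (X n) = dirichlet \<alpha>"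
  shows "(\<forall>N\<ge>1. \<forall>x :: nat \<Rightarrow> (real, 'k) vec. (\<forall>n\<in>{1..N}. x n \<in> open_simplex) \<longrightarrow>
            (\<forall>a. is_maximum_likelihood dirichlet_density positive_vecs N x a \<longleftrightarrow>
                 a \<in> positive_vecs \<and> dirichlet_likelihood_system N x a) \<and>
            (\<exists>\<^sub>\<le>\<^sub>1 a. a \<in> positive_vecs \<and> dirichlet_likelihood_system N x a))
       \<and> moment_type_estimator (dirichlet :: (real, 'k) vec \<Rightarrow> _) positive_vecs open_simplex log_vec dirichlet_mle
       \<and> (\<forall>i. integrable (dirichlet \<alpha>) (\<lambda>x. (ln (x $ i))\<^sup>2))
       \<and> invertible (covariance_matrix (dirichlet \<alpha>) log_vec)
       \<and> has_asymptotic_covariance M \<alpha> (\<lambda>N \<omega>. dirichlet_mle N (\<lambda>n. X n \<omega>))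
           (matrix_inv (covariance_matrix (dirichlet \<alpha>) log_vec))"
proof (intro conjI allI impI)
  fix N and x :: "nat \<Rightarrow> (real, 'k) vec" and a
  assume N: "1 \<le> N" and x: "\<forall>n\<in>{1..N}. x n \<in> open_simplex"
  show "is_maximum_likelihood dirichlet_density positive_vecs N x a \<longleftrightarrow>
      a \<in> positive_vecs \<and> dirichlet_likelihood_system N x a"
    unfolding is_maximum_likelihood_dirichlet_iff[OF assms(1) N x] dirichlet_likelihood_system_iff ..
  show "\<exists>\<^sub>\<le>\<^sub>1 a. a \<in> positive_vecs \<and> dirichlet_likelihood_system N x a"
    unfolding dirichlet_likelihood_system_iff
    using inj_onD[OF inj_on_dirichlet_mean_log[OF assms(1)]] by (auto intro!: Uniq_I)
next
  show "moment_type_estimator (dirichlet :: (real, 'k) vec \<Rightarrow> _) positive_vecs open_simplex log_vec dirichlet_mle"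
    by (rule moment_type_estimator_dirichlet_mle[OF assms(1)])
  show "integrable (dirichlet \<alpha>) (\<lambda>x. (ln (x $ i))\<^sup>2)" for i
    using dirichlet_log_square_integrable[OF assms(1,2), of "axis i 1"] by (simp add: inner_axis' log_vec_def)
  show "invertible (covariance_matrix (dirichlet \<alpha>) log_vec)"
    unfolding covariance_matrix_log_dirichlet[OF assms(1,2)]
    by (rule invertible_dirichlet_information[OF assms(1,2)])
  show "has_asymptotic_covariance M \<alpha> (\<lambda>N \<omega>. dirichlet_mle N (\<lambda>n. X n \<omega>))
      (matrix_inv (covariance_matrix (dirichlet \<alpha>) log_vec))"
    unfolding covariance_matrix_log_dirichlet[OF assms(1,2)]
    by (rule has_asymptotic_covariance_dirichlet_mle[OF assms])
qed

end
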